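(* Let $n\ge2$ and let $J=\bigoplus_{k=1}^n\left(J_{m_k}(\lambda_k)\otimes 1_{d_k}\right)$, where $\lambda_1>\lambda_2>\cdots>\lambda_n$ are real, and suppose $\max\{m_2,\ldots,m_{n-1}\}\leq\min\{m_1,m_n\}$. Then, up to $*$-isomorphism, \[ C^*_{\rm e}(\mathcal{OS}(J))=\begin{cases} M_{m_1}(\mathbb{C})\oplus M_{m_n}(\mathbb{C})&\text{if }\min\{m_1,m_n\}\geq2, \\ \mathbb{C}\oplus\mathbb{C}&\text{if }m_1=m_n=1,\\ M_{m_n}(\mathbb{C})&\text{if }m_1=1,\ m_n\geq2,\ |\lambda_1-\lambda_n|\leq\cos\frac{\pi}{m_n+1}, \\ \mathbb{C}\oplus M_{m_n}(\mathbb{C})&\text{if }m_1=1,\ m_n\geq2,\ |\lambda_1-\lambda_n|>\cos\frac{\pi}{m_n+1}, \\ M_{m_1}(\mathbb{C})&\text{if }m_1\geq2,\ m_n=1,\ |\lambda_1-\lambda_n|\leq\cos\frac{\pi}{m_1+1}, \\ M_{m_1}(\mathbb{C})\oplus\mathbb{C}&\text{if }m_1\geq2,\ m_n=1,\ |\lambda_1-\lambda_n|>\cos\frac{\pi}{m_1+1}. \end{cases} \]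
   Context: $J_m(\lambda)\in M_m(\mathbb{C})$ is the basic Jordan block of size $m\ge1$ with $\lambda$ on the diagonal, $1$ on the first superdiagonal and $0$ elsewhere. $J_m(\lambda)\otimes1_d$ denotes the direct sum of $d\geq1$ copies of $J_m(\lambda)$. When $n=2$ the condition on $\max\{m_2,\dots,m_{n-1}\}$ is vacuous. For a bounded operator $T$ on a complex Hilbert space $\mathcal{H}$, $\mathcal{OS}(T)=\mathrm{span}\{1,T,T^*\}\subset\mathcal{B}(\mathcal{H})$, and $C^*(T)$ is the unital C$^*$-algebra generated by $\mathcal{OS}(T)$. The C$^*$-envelope is $C^*_{\rm e}(\mathcal{OS}(T))=C^*(T)/\mathfrak{S}$, where $\mathfrak{S}$ is the Šilov ideal, i.e. the largest closed two-sided ideal $\mathcal{K}$ of $C^*(T)$ such that the quotient map $C^*(T)\to C^*(T)/\mathcal{K}$ is completely isometric on $\mathcal{OS}(T)$. Equivalently, $\mathfrak{S}$ is the intersection of the kernels of all boundary representations for $\mathcal{OS}(T)$, where a boundary representation is an irreducible unital $*$-representation $\rho:C^*(T)\to\mathcal{B}(\mathcal{H}_\rho)$ such that $\rho$ is the unique unital completely positive extension of $\rho|_{\mathcal{OS}(T)}$ to $C^*(T)$. *)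

theory Defs
  imports
    "Jordan_Normal_Form.Jordan_Normal_Form"
    "Jordan_Normal_Form.Schur_Decomposition"
    "HOL-Algebra.QuotRing"
    "HOL-Analysis.L2_Norm"
begin

text \<open>
  Operators on the Hilbert space \<open>\<complex>\<^sup>N\<close> are the complex matrices in \<open>carrier_mat N N\<close>;
  the Hilbert space adjoint is \<^const>\<open>mat_adjoint\<close>.
\<close>

subsection \<open>Complex unital *-algebras\<close>

record 'a star_alg = "(complex, 'a) module" +
  adj :: "'a \<Rightarrow> 'a"

text \<open>
  Members of \<^const>\<open>ring_iso\<close> are unital.  A bijective *-homomorphism between C*-algebras is
  automatically isometric, so no norm has to be mentioned.
\<close>

definition star_isomorphic :: "'a star_alg \<Rightarrow> 'b star_alg \<Rightarrow> bool" where
  "star_isomorphic A B \<longleftrightarrow>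
     (\<exists>\<phi> \<in> ring_iso A B. \<forall>x \<in> carrier A.
        (\<forall>c. \<phi> (c \<odot>\<^bsub>A\<^esub> x) = c \<odot>\<^bsub>B\<^esub> \<phi> x) \<and> \<phi> (adj A x) = adj B (\<phi> x))"

definition complex_alg :: "complex star_alg" where
  "complex_alg =
     \<lparr> carrier = UNIV, mult = (*), one = 1, zero = 0, add = (+), smult = (*), adj = cnj \<rparr>"

definition sub_mat_alg :: "nat \<Rightarrow> complex mat set \<Rightarrow> complex mat star_alg" where
  "sub_mat_alg N A =
     \<lparr> carrier = A, mult = (*), one = 1\<^sub>m N, zero = 0\<^sub>m N N, add = (+),
       smult = (\<cdot>\<^sub>m), adj = mat_adjoint \<rparr>"

definition mat_alg :: "nat \<Rightarrow> complex mat star_alg" where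
  "mat_alg N = sub_mat_alg N (carrier_mat N N)"

definition dsum_alg :: "'a star_alg \<Rightarrow> 'b star_alg \<Rightarrow> ('a \<times> 'b) star_alg" where
  "dsum_alg A B =
     \<lparr> carrier = carrier A \<times> carrier B,
       mult = (\<lambda>(a, b) (a', b'). (a \<otimes>\<^bsub>A\<^esub> a', b \<otimes>\<^bsub>B\<^esub> b')),
       one = (\<one>\<^bsub>A\<^esub>, \<one>\<^bsub>B\<^esub>),
       zero = (\<zero>\<^bsub>A\<^esub>, \<zero>\<^bsub>B\<^esub>),
       add = (\<lambda>(a, b) (a', b'). (a \<oplus>\<^bsub>A\<^esub> a', b \<oplus>\<^bsub>B\<^esub> b')),
       smult = (\<lambda>c (a, b). (c \<odot>\<^bsub>A\<^esub> a, c \<odot>\<^bsub>B\<^esub> b)),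
       adj = (\<lambda>(a, b). (adj A a, adj B b)) \<rparr>"

text \<open>
  The unions below range over the representatives \<open>x\<close> of the coset \<open>X\<close>; for a *-closed ideal
  all of them give the same coset.
\<close>

definition quot_alg :: "'a star_alg \<Rightarrow> 'a set \<Rightarrow> 'a set star_alg" where
  "quot_alg A K =
     \<lparr> carrier = carrier (A Quot K), mult = mult (A Quot K), one = one (A Quot K),
       zero = zero (A Quot K), add = add (A Quot K),
       smult = (\<lambda>c X. \<Union>x\<in>X. K +>\<^bsub>A\<^esub> (c \<odot>\<^bsub>A\<^esub> x)),
       adj = (\<lambda>X. \<Union>x\<in>X. K +>\<^bsub>A\<^esub> adj A x) \<rparr>"

subsection \<open>Operator norm and matrix amplifications\<close>

definition vnorm :: "complex vec \<Rightarrow> real" where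
  "vnorm v = L2_set (\<lambda>i. cmod (v $ i)) {..<dim_vec v}"

definition op_norm :: "complex mat \<Rightarrow> real" where
  "op_norm A = (SUP v \<in> {v \<in> carrier_vec (dim_col A). vnorm v \<le> 1}. vnorm (A *\<^sub>v v))"

definition norm_closed :: "nat \<Rightarrow> complex mat set \<Rightarrow> bool" where
  "norm_closed N S \<longleftrightarrow>
     (\<forall>X L. (\<forall>i::nat. X i \<in> S) \<and> L \<in> carrier_mat N N \<and> (\<lambda>i. op_norm (X i - L)) \<longlonglongrightarrow> 0
        \<longrightarrow> L \<in> S)"

text \<open>
  The identification \<open>M\<^sub>p(M\<^sub>N(\<complex>)) = M\<^sub>p\<^sub>N(\<complex>)\<close>: \<open>X i j\<close> becomes the block in position \<open>(i, j)\<close>.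
\<close>

definition block_mat :: "nat \<Rightarrow> nat \<Rightarrow> (nat \<Rightarrow> nat \<Rightarrow> complex mat) \<Rightarrow> complex mat" where
  "block_mat p N X =
     mat (p * N) (p * N) (\<lambda>(i, j). X (i div N) (j div N) $$ (i mod N, j mod N))"

text \<open>
  The norm of \<open>M\<^sub>p(A/K)\<close>, for \<open>A \<subseteq> M\<^sub>N(\<complex>)\<close>, is the quotient norm of \<open>M\<^sub>p(A)/M\<^sub>p(K)\<close>.  Its
  elements are given as \<open>p \<times> p\<close> arrays \<open>Z\<close> of cosets, so the infimum is taken over all choices
  of representatives.
\<close>

definition quot_mat_norm :: "nat \<Rightarrow> nat \<Rightarrow> (nat \<Rightarrow> nat \<Rightarrow> complex mat set) \<Rightarrow> real" where
  "quot_mat_norm p N Z =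
     Inf {op_norm (block_mat p N Y) | Y. \<forall>i<p. \<forall>j<p. Y i j \<in> Z i j}"

subsection \<open>The C*-envelope of the operator system of a matrix\<close>

text \<open>From here on \<open>T\<close> is meant to be a square matrix, acting on \<open>\<complex>\<^sup>N\<close> with \<open>N = dim_row T\<close>.\<close>

definition op_system :: "complex mat \<Rightarrow> complex mat set" where
  "op_system T =
     {a \<cdot>\<^sub>m 1\<^sub>m (dim_row T) + b \<cdot>\<^sub>m T + c \<cdot>\<^sub>m mat_adjoint T | a b c. True}"

definition unital_cstar_subalgebra :: "nat \<Rightarrow> complex mat set \<Rightarrow> bool" where
  "unital_cstar_subalgebra N A \<longleftrightarrow>
     A \<subseteq> carrier_mat N N \<and> 1\<^sub>m N \<in> A \<and>
     (\<forall>X\<in>A. \<forall>Y\<in>A. X + Y \<in> A \<and> X * Y \<in> A) \<and>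
     (\<forall>c. \<forall>X\<in>A. c \<cdot>\<^sub>m X \<in> A) \<and>
     (\<forall>X\<in>A. mat_adjoint X \<in> A) \<and>
     norm_closed N A"

definition cstar_gen :: "complex mat \<Rightarrow> complex mat star_alg" where
  "cstar_gen T =
     sub_mat_alg (dim_row T)
       (\<Inter>{A. unital_cstar_subalgebra (dim_row T) A \<and> op_system T \<subseteq> A})"

text \<open>
  Closed two-sided ideals \<open>K\<close> of \<open>C*(T)\<close> for which the quotient map \<open>x \<mapsto> K + x\<close> is completely
  isometric on \<open>OS(T)\<close>.  Ring ideals of a unital algebra are automatically linear subspaces.
\<close>

definition boundary_ideal :: "complex mat \<Rightarrow> complex mat set \<Rightarrow> bool" where
  "boundary_ideal T K \<longleftrightarrow>
     ideal K (cstar_gen T) \<and> norm_closed (dim_row T) K \<and>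
     (\<forall>p>0. \<forall>X. (\<forall>i<p. \<forall>j<p. X i j \<in> op_system T) \<longrightarrow>
        quot_mat_norm p (dim_row T) (\<lambda>i j. K +>\<^bsub>cstar_gen T\<^esub> X i j)
          = op_norm (block_mat p (dim_row T) X))"

text \<open>The largest boundary ideal with respect to inclusion (it exists by theorems of Arveson and Hamana).\<close>

definition shilov_ideal :: "complex mat \<Rightarrow> complex mat set" where
  "shilov_ideal T = (GREATEST K. boundary_ideal T K)"

definition cstar_envelope :: "complex mat \<Rightarrow> complex mat set star_alg" where
  "cstar_envelope T = quot_alg (cstar_gen T) (shilov_ideal T)"

subsection \<open>Direct sums of multiples of real Jordan blocks\<close>

text \<open>\<open>J\<^bsub>m 1\<^esub>(l 1) \<otimes> 1\<^bsub>d 1\<^esub> \<oplus> \<dots> \<oplus> J\<^bsub>m n\<^esub>(l n) \<otimes> 1\<^bsub>d n\<^esub>\<close>\<close>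

definition jordan_sum ::
  "nat \<Rightarrow> (nat \<Rightarrow> nat) \<Rightarrow> (nat \<Rightarrow> nat) \<Rightarrow> (nat \<Rightarrow> real) \<Rightarrow> complex mat" where
  "jordan_sum n m d l =
     jordan_matrix (concat (map (\<lambda>k. replicate (d k) (m k, complex_of_real (l k))) [1..<Suc n]))"

end

theory Submission
  imports Defs
begin

text \<open>
  Let \<open>J\<^sub>k\<close> be the \<open>k\<close>-th Jordan block of \<open>T\<close>.  The eigenvalues are distinct, so polynomials in \<open>T\<close>
  produce the corner matrix unit of a single block, and \<open>T*\<close> moves it to all the other positions.
  Hence \<open>C*(T)\<close> consists of all block diagonal matrices that repeat the same block at the copies of
  \<open>J\<^sub>k\<close> (\<open>cstar_gen_eq\<close>); it is the direct sum of the full matrix algebras of size \<open>m k\<close>, and its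
  quotient by the ideal of the elements that vanish on a set \<open>F\<close> of blocks is the direct sum of the
  matrix algebras that belong to \<open>F\<close>.  The theorem amounts to finding the set \<open>F\<close> that belongs to the
  Shilov ideal.  Two observations decide this.

  A block \<open>J\<^sub>k\<close> may be dropped if it is a convex combination of compressions of blocks in \<open>F\<close>: the same
  combination then expresses the \<open>k\<close>-th block of every matrix over the operator system by its blocks
  in \<open>F\<close>, so that the former never determines the norm (\<open>boundary_idealI\<close>).  For an intermediate block
  write \<open>l k = t l\<^sub>1 + (1 - t) l\<^sub>n\<close>; as \<open>m k\<close> is at most \<open>m 1\<close> and \<open>m n\<close>, the block is \<open>t\<close> times a corner of
  \<open>J\<^sub>1\<close> plus \<open>1 - t\<close> times a corner of \<open>J\<^sub>n\<close>.  So \<open>F = {1, n}\<close> always suffices.  If \<open>m 1 = 1\<close> then all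
  blocks but the last are scalars, and they can be obtained from \<open>J\<^sub>n\<close> alone as soon as they lie in its
  numerical range, which is the disc around \<open>l\<^sub>n\<close> with radius \<open>cos (\<pi> / (m n + 1))\<close>; the eigenvector
  \<open>sin (j \<pi> / (m n + 1))\<close> of the real part of the shift attains the radius.

  A block \<open>J\<^sub>f\<close> cannot be dropped if some element of the operator system is strictly larger in norm
  on \<open>J\<^sub>f\<close> than on every other block: an ideal that does not vanish on \<open>J\<^sub>f\<close> contains the unit of that
  block, and passing to the quotient lowers the norm of this element (\<open>boundary_ideal_subset\<close>).
  For \<open>J\<^sub>1\<close> one takes \<open>T - l\<^sub>n\<close>, whose blocks are a shift plus a nonnegative scalar; their norms grow
  strictly with the scalar and weakly with the size.  The last block, where the scalar is \<open>0\<close>, may be the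
  largest, but its norm is at most \<open>1\<close>, while the first one exceeds \<open>1\<close> if its size is at least \<open>2\<close>.
  If \<open>m 1 = 1\<close> and \<open>l\<^sub>1 - l\<^sub>n > cos (\<pi> / (m n + 1))\<close>, one takes \<open>T + T* - 2 l\<^sub>n\<close>.  The block \<open>J\<^sub>n\<close> is
  treated in the same way with \<open>l\<^sub>1 - T\<close> and \<open>2 l\<^sub>1 - T - T*\<close>; a sign \<open>\<sigma>\<close> covers both ends at once.
\<close>

section \<open>Sesquilinear forms and the operator norm\<close>

text \<open>
  Vectors of \<open>\<complex>\<^sup>N\<close> are represented by functions on the natural numbers that are only looked at below
  \<open>N\<close>.  Cutting a vector into pieces, padding it and restricting it then need no dimension bookkeeping.
\<close>

definition fnorm :: "nat \<Rightarrow> (nat \<Rightarrow> complex) \<Rightarrow> real" where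
  "fnorm N u = L2_set (\<lambda>a. cmod (u a)) {..<N}"

definition sesq :: "nat \<Rightarrow> complex mat \<Rightarrow> (nat \<Rightarrow> complex) \<Rightarrow> (nat \<Rightarrow> complex) \<Rightarrow> complex" where
  "sesq N A u v = (\<Sum>a<N. \<Sum>b<N. cnj (u a) * A $$ (a, b) * v b)"

definition fip :: "nat \<Rightarrow> (nat \<Rightarrow> complex) \<Rightarrow> (nat \<Rightarrow> complex) \<Rightarrow> complex" where
  "fip N u v = (\<Sum>a<N. cnj (u a) * v a)"

definition fmul :: "nat \<Rightarrow> complex mat \<Rightarrow> (nat \<Rightarrow> complex) \<Rightarrow> nat \<Rightarrow> complex" where
  "fmul N A v = (\<lambda>a. \<Sum>b<N. A $$ (a, b) * v b)"

lemma fnorm_nonneg [simp]: "0 \<le> fnorm N u"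
  by (simp add: fnorm_def)

lemma fnorm_power2: "(fnorm N u)\<^sup>2 = (\<Sum>a<N. (cmod (u a))\<^sup>2)"
  by (simp add: fnorm_def L2_set_def sum_nonneg)

lemma fip_self: "fip N u u = complex_of_real ((fnorm N u)\<^sup>2)"
  unfolding fip_def fnorm_power2 of_real_sum
  by (intro sum.cong refl) (metis complex_norm_square mult.commute of_real_power)

lemma sesq_eq_fip: "sesq N A u v = fip N u (fmul N A v)"
  by (simp add: sesq_def fip_def fmul_def sum_distrib_left mult.assoc)

lemma fip_bound: "cmod (fip N u v) \<le> fnorm N u * fnorm N v"
proof -
  have "cmod (fip N u v) \<le> (\<Sum>a<N. \<bar>cmod (u a)\<bar> * \<bar>cmod (v a)\<bar>)"
    unfolding fip_def by (rule order_trans[OF norm_sum]) (simp add: norm_mult)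
  also have "\<dots> \<le> fnorm N u * fnorm N v" unfolding fnorm_def by (rule L2_set_mult_ineq)
  finally show ?thesis .
qed

lemma vnorm_vec: "vnorm (vec N u) = fnorm N u"
  unfolding vnorm_def fnorm_def by (rule L2_set_cong) auto

lemma mult_mat_vec_vec:
  assumes "A \<in> carrier_mat N N"
  shows "A *\<^sub>v vec N u = vec N (fmul N A u)"
  using assms by (intro eq_vecI) (auto simp: fmul_def scalar_prod_def row_def atLeast0LessThan)

lemma fnorm_cmult: "fnorm N (\<lambda>a. c * u a) = cmod c * fnorm N u"
  unfolding fnorm_def by (subst L2_set_right_distrib) (auto simp: norm_mult)

lemma fmul_cmult: "fmul N A (\<lambda>a. c * u a) = (\<lambda>a. c * fmul N A u a)"
  by (simp add: fmul_def sum_distrib_left algebra_simps)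

lemma op_norm_set:
  assumes "A \<in> carrier_mat N N"
  shows "(\<lambda>v. vnorm (A *\<^sub>v v)) ` {v \<in> carrier_vec (dim_col A). vnorm v \<le> 1}
          = {fnorm N (fmul N A u) | u. fnorm N u \<le> 1}" (is "?L = ?R")
proof -
  have dim: "dim_col A = N" using assms by auto
  show ?thesis
  proof (intro equalityI subsetI)
    fix r assume "r \<in> ?L"
    then obtain v where v: "v \<in> carrier_vec N" "vnorm v \<le> 1" "r = vnorm (A *\<^sub>v v)"
      unfolding dim by auto
    have "v = vec N (\<lambda>i. v $ i)" using v(1) by auto
    then show "r \<in> ?R" using v assms
      by (metis (mono_tags, lifting) mem_Collect_eq mult_mat_vec_vec vnorm_vec)
  next
    fix r assume "r \<in> ?R"
    then obtain u where "fnorm N u \<le> 1" "r = fnorm N (fmul N A u)" by auto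
    then show "r \<in> ?L" unfolding dim
      by (intro image_eqI[of _ _ "vec N u"]) (auto simp: mult_mat_vec_vec[OF assms] vnorm_vec)
  qed
qed

lemma op_norm_bdd: "bdd_above {fnorm N (fmul N A u) | u. fnorm N u \<le> 1}"
proof (rule bdd_aboveI)
  fix r assume "r \<in> {fnorm N (fmul N A u) | u. fnorm N u \<le> 1}"
  then obtain u where u: "fnorm N u \<le> 1" and r: "r = fnorm N (fmul N A u)" by auto
  have 1: "cmod (u b) \<le> 1" if "b < N" for b
    using u member_le_L2_set[of "{..<N}" b "\<lambda>a. cmod (u a)"] that by (simp add: fnorm_def)
  have "r \<le> (\<Sum>a<N. cmod (fmul N A u a))" unfolding r fnorm_def by (rule L2_set_le_sum) auto
  also have "\<dots> \<le> (\<Sum>a<N. \<Sum>b<N. cmod (A $$ (a, b)))"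
    unfolding fmul_def
    by (intro sum_mono order_trans[OF norm_sum]) (auto simp: norm_mult intro!: mult_left_le 1)
  finally show "r \<le> (\<Sum>a<N. \<Sum>b<N. cmod (A $$ (a, b)))" .
qed

lemma op_norm_eq:
  assumes "A \<in> carrier_mat N N"
  shows "op_norm A = Sup {fnorm N (fmul N A u) | u. fnorm N u \<le> 1}"
  unfolding op_norm_def op_norm_set[OF assms] by simp

lemma fnorm_0 [simp]: "fnorm N (\<lambda>_. 0) = 0"
  by (simp add: fnorm_def L2_set_def)

lemma op_norm_nonneg:
  assumes "A \<in> carrier_mat N N"
  shows "0 \<le> op_norm A"
proof -
  have "fnorm N (fmul N A (\<lambda>_. 0)) \<le> op_norm A"
    unfolding op_norm_eq[OF assms] by (rule cSup_upper[OF _ op_norm_bdd])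
        (auto intro!: exI[of _ "\<lambda>_. 0"])
  then show ?thesis using fnorm_nonneg order_trans by blast
qed

lemma fnorm_fmul_le:
  assumes "A \<in> carrier_mat N N"
  shows "fnorm N (fmul N A u) \<le> op_norm A * fnorm N u"
proof (cases "fnorm N u = 0")
  case True
  then have "\<And>b. b < N \<Longrightarrow> u b = 0" by (auto simp: fnorm_def L2_set_eq_0_iff)
  then have "fmul N A u = (\<lambda>_. 0)" by (auto simp: fmul_def)
  then show ?thesis using True by simp
next
  case False
  then have pos: "0 < fnorm N u" by (simp add: order_less_le)
  let ?c = "complex_of_real (1 / fnorm N u)"
  have "fnorm N (\<lambda>a. ?c * u a) \<le> 1"
    using pos by (subst fnorm_cmult) (simp add: norm_divide)
  then have "fnorm N (fmul N A (\<lambda>a. ?c * u a)) \<le> op_norm A"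
    unfolding op_norm_eq[OF assms] by (intro cSup_upper[OF _ op_norm_bdd]) blast
  then have "1 / fnorm N u * fnorm N (fmul N A u) \<le> op_norm A"
    unfolding fmul_cmult fnorm_cmult norm_of_real using pos by simp
  then show ?thesis using pos by (simp add: field_simps)
qed

lemma op_norm_leI:
  assumes "A \<in> carrier_mat N N" "0 \<le> c" "\<And>u. fnorm N (fmul N A u) \<le> c * fnorm N u"
  shows "op_norm A \<le> c"
  unfolding op_norm_eq[OF assms(1)]
proof (rule cSup_least)
  show "{fnorm N (fmul N A u) | u. fnorm N u \<le> 1} \<noteq> {}" by (auto intro!: exI[of _ "\<lambda>_. 0"])
  fix r assume "r \<in> {fnorm N (fmul N A u) | u. fnorm N u \<le> 1}"
  then obtain u where u: "fnorm N u \<le> 1" and r: "r = fnorm N (fmul N A u)" by auto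
  have "r \<le> c * fnorm N u" using assms(3) r by simp
  also have "\<dots> \<le> c" using u assms(2) by (simp add: mult_left_le)
  finally show "r \<le> c" .
qed

lemma sesq_le_op_norm:
  assumes "A \<in> carrier_mat N N"
  shows "cmod (sesq N A u v) \<le> op_norm A * fnorm N u * fnorm N v"
proof -
  have "cmod (sesq N A u v) \<le> fnorm N u * fnorm N (fmul N A v)"
    unfolding sesq_eq_fip by (rule fip_bound)
  also have "\<dots> \<le> fnorm N u * (op_norm A * fnorm N v)"
    by (intro mult_left_mono fnorm_fmul_le assms) auto
  finally show ?thesis by (simp add: algebra_simps)
qed

text \<open>
  Norm bounds on matrices are proved through their sesquilinear forms, since forms split into
  summands along block decompositions more conveniently than images of vectors do.
\<close>

lemma op_norm_le_sesqI:
  assumes "A \<in> carrier_mat N N" "0 \<le> c" "\<And>u v. cmod (sesq N A u v) \<le> c * fnorm N u * fnorm N v"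
  shows "op_norm A \<le> c"
proof (rule op_norm_leI[OF assms(1,2)])
  fix u
  let ?w = "fmul N A u"
  have "(fnorm N ?w)\<^sup>2 = cmod (sesq N A ?w u)"
    unfolding sesq_eq_fip fip_self by (simp only: norm_of_real) simp
  also have "\<dots> \<le> c * fnorm N ?w * fnorm N u" by (rule assms(3))
  finally have "fnorm N ?w * fnorm N ?w \<le> fnorm N ?w * (c * fnorm N u)"
    by (simp add: power2_eq_square algebra_simps)
  then show "fnorm N ?w \<le> c * fnorm N u"
    using assms(2) by (cases "fnorm N ?w = 0") (auto simp: mult_le_cancel_left order_less_le)
qed

text \<open>
  This turns convergence in norm into convergence of the entries.
\<close>

lemma cmod_entry_le_op_norm:
  assumes A: "A \<in> carrier_mat N N" and ij: "i < N" "j < N"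
  shows "cmod (A $$ (i, j)) \<le> op_norm A"
proof -
  let ?e = "\<lambda>k a. if a = k then 1 else 0 :: complex"
  have n: "fnorm N (?e k) = 1" if "k < N" for k
  proof -
    have "(fnorm N (?e k))\<^sup>2 = 1\<^sup>2" unfolding fnorm_power2
      using that by (simp add: if_distrib[of cmod] if_distrib[of "\<lambda>x. x\<^sup>2"] cong: if_cong)
    then show ?thesis by (rule power2_eq_imp_eq) auto
  qed
  have "sesq N A (?e i) (?e j) = A $$ (i, j)"
    unfolding sesq_def using ij
    by (simp add: if_distrib[of cnj] if_distrib[of "\<lambda>x. x * _"] if_distrib[of "\<lambda>x. _ * x"]
    cong: if_cong)
  then show ?thesis using sesq_le_op_norm[OF A, of "?e i" "?e j"] ij by (simp add: n)
qed

section \<open>Matrices over matrix algebras\<close>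

text \<open>
  A vector of \<open>\<complex>\<^sup>p\<^sup>N\<close> is a family of \<open>p\<close> vectors of \<open>\<complex>\<^sup>N\<close>.
\<close>

definition block_fnorm :: "nat \<Rightarrow> nat \<Rightarrow> (nat \<Rightarrow> nat \<Rightarrow> complex) \<Rightarrow> real" where
  "block_fnorm p N u = L2_set (\<lambda>i. fnorm N (u i)) {..<p}"

definition block_sesq :: "nat \<Rightarrow> nat \<Rightarrow> (nat \<Rightarrow> nat \<Rightarrow> complex mat) \<Rightarrow> (nat \<Rightarrow> nat \<Rightarrow> complex)
    \<Rightarrow> (nat \<Rightarrow> nat \<Rightarrow> complex) \<Rightarrow> complex" where
  "block_sesq p N X u v = (\<Sum>i<p. \<Sum>j<p. sesq N (X i j) (u i) (v j))"

lemma sum_lessThan_mult: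
  fixes f :: "nat \<Rightarrow> 'a :: comm_monoid_add"
  shows "(\<Sum>k<p * N. f k) = (\<Sum>i<p. \<Sum>a<N. f (i * N + a))"
proof -
  have "(\<Sum>k<p * N. f k) = (\<Sum>i<p. sum f {i * N..<i * N + N})"
    by (rule sum.nat_group[symmetric])
  also have "\<dots> = (\<Sum>i<p. \<Sum>a<N. f (i * N + a))"
    by (rule sum.cong[OF refl])
      (subst sum.atLeastLessThan_shift_0, simp add: atLeast0LessThan add.commute)
  finally show ?thesis .
qed

lemma block_mat_carrier [simp]: "block_mat p N X \<in> carrier_mat (p * N) (p * N)"
  by (simp add: block_mat_def)

lemma block_index_less: "i < p \<Longrightarrow> a < N \<Longrightarrow> i * N + a < p * (N :: nat)"
  using mult_le_mono1[of "Suc i" p N] by simp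

lemma sesq_block_mat:
  "sesq (p * N) (block_mat p N X) u v =
     block_sesq p N X (\<lambda>i a. u (i * N + a)) (\<lambda>i a. v (i * N + a))"
proof -
  have "sesq (p * N) (block_mat p N X) u v =
     (\<Sum>i<p. \<Sum>a<N. \<Sum>j<p. \<Sum>b<N. cnj (u (i * N + a)) * X i j $$ (a, b) * v (j * N + b))"
    unfolding sesq_def sum_lessThan_mult
    by (intro sum.cong refl) (auto simp: block_mat_def block_index_less)
  also have "\<dots> = block_sesq p N X (\<lambda>i a. u (i * N + a)) (\<lambda>i a. v (i * N + a))"
    unfolding block_sesq_def sesq_def by (rule sum.cong[OF refl], rule sum.swap)
  finally show ?thesis .
qed

lemma block_fnorm_power2: "(block_fnorm p N u)\<^sup>2 = (\<Sum>i<p. (fnorm N (u i))\<^sup>2)"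
  by (simp add: block_fnorm_def L2_set_def sum_nonneg)

lemma block_fnorm_nonneg [simp]: "0 \<le> block_fnorm p N u"
  by (simp add: block_fnorm_def)

lemma fnorm_eq_block_fnorm: "fnorm (p * N) u = block_fnorm p N (\<lambda>i a. u (i * N + a))"
  by (rule power2_eq_imp_eq) (auto simp: fnorm_power2 block_fnorm_power2 sum_lessThan_mult)

lemma op_norm_block_mat_leI:
  assumes "0 \<le> c" "\<And>u v. cmod (block_sesq p N X u v) \<le> c * block_fnorm p N u * block_fnorm p N v"
  shows "op_norm (block_mat p N X) \<le> c"
  using assms by (intro op_norm_le_sesqI[OF block_mat_carrier])
      (auto simp: sesq_block_mat fnorm_eq_block_fnorm)

lemma block_sesq_le_op_norm:
  "cmod (block_sesq p N X u v) \<le> op_norm (block_mat p N X) * block_fnorm p N u * block_fnorm p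
      N v"
proof -
  let ?f = "\<lambda>u k. u (k div N) (k mod N)"
  have e: "block_fnorm p N (\<lambda>i a. ?f u (i * N + a)) = block_fnorm p N u"
    for u :: "nat \<Rightarrow> nat \<Rightarrow> complex"
    unfolding block_fnorm_def fnorm_def by (intro L2_set_cong refl) auto
  have "block_sesq p N X (\<lambda>i a. ?f u (i * N + a)) (\<lambda>i a. ?f v (i * N + a)) = block_sesq p N X u v"
    unfolding block_sesq_def sesq_def by (intro sum.cong refl) auto
  then have "block_sesq p N X u v = sesq (p * N) (block_mat p N X) (?f u) (?f v)"
    by (simp add: sesq_block_mat)
  also have "cmod \<dots> \<le> op_norm (block_mat p N X) * block_fnorm p N u * block_fnorm p N v"
    using sesq_le_op_norm[OF block_mat_carrier, of p N X "?f u" "?f v"]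
    by (simp only: fnorm_eq_block_fnorm e)
  finally show ?thesis .
qed

section \<open>Block diagonal matrices\<close>

lemma sum_lessThan_add:
  fixes g :: "nat \<Rightarrow> 'a :: comm_monoid_add"
  shows "(\<Sum>i<A + B. g i) = (\<Sum>i<A. g i) + (\<Sum>a<B. g (A + a))"
  by (induction B) (auto simp: add.assoc)

lemma sum_lessThan_sum:
  fixes g :: "nat \<Rightarrow> 'a :: comm_monoid_add" and s :: "nat \<Rightarrow> nat"
  shows "(\<Sum>i<(\<Sum>b<L. s b). g i) = (\<Sum>b<L. \<Sum>a<s b. g ((\<Sum>c<b. s c) + a))"
  by (induction L) (auto simp: sum_lessThan_add)

lemma partial_sum_less:
  fixes s :: "nat \<Rightarrow> nat"
  assumes "b < L" "a < s b"
  shows "(\<Sum>c<b. s c) + a < (\<Sum>c<L. s c)"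
proof -
  have "(\<Sum>c<b. s c) + a < (\<Sum>c<Suc b. s c)" using assms by simp
  also have "\<dots> \<le> (\<Sum>c<L. s c)" using assms by (intro sum_mono2) auto
  finally show ?thesis .
qed

lemma partial_sum_cover:
  fixes s :: "nat \<Rightarrow> nat"
  assumes "i < (\<Sum>c<L. s c)"
  obtains b a where "b < L" "a < s b" "i = (\<Sum>c<b. s c) + a"
  using assms
proof (induction L arbitrary: thesis)
  case (Suc L)
  show ?case
  proof (cases "i < (\<Sum>c<L. s c)")
    case True
    then show ?thesis using Suc.IH Suc.prems(1) less_SucI by metis
  next
    case False
    then show ?thesis using Suc.prems(1)[of L "i - (\<Sum>c<L. s c)"] Suc.prems(2) by auto
  qed
qed auto

lemma diag_block_mat_carrier:
  assumes "\<forall>b<length As. As ! b \<in> carrier_mat (s b) (s b)"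
  shows "diag_block_mat As \<in> carrier_mat (\<Sum>b<length As. s b) (\<Sum>b<length As. s b)"
  using assms
proof (induction As arbitrary: s)
  case (Cons A As)
  have "diag_block_mat As \<in> carrier_mat (\<Sum>b<length As. s (Suc b)) (\<Sum>b<length As. s (Suc b))"
    using Cons by fastforce
  moreover have "A \<in> carrier_mat (s 0) (s 0)" using Cons.prems by fastforce
  ultimately show ?case by (simp add: Let_def sum.lessThan_Suc_shift del: sum.lessThan_Suc)
qed simp

lemma diag_block_mat_index:
  assumes "\<forall>b<length As. As ! b \<in> carrier_mat (s b) (s b)"
    and "b < length As" "a < s b" "b' < length As" "a' < s b'"
  shows "diag_block_mat As $$ ((\<Sum>c<b. s c) + a, (\<Sum>c<b'. s c) + a')
        = (if b = b' then As ! b $$ (a, a') else 0)"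
  using assms
proof (induction As arbitrary: s b b')
  case (Cons A As)
  note 2 = Cons.prems
  let ?s = "\<lambda>c. s (Suc c)"
  have tl: "\<forall>b<length As. As ! b \<in> carrier_mat (?s b) (?s b)" using 2(1) by fastforce
  have c: "diag_block_mat As \<in> carrier_mat (\<Sum>b<length As. ?s b) (\<Sum>b<length As. ?s b)"
    by (rule diag_block_mat_carrier[OF tl])
  have A: "A \<in> carrier_mat (s 0) (s 0)" using 2(1) by fastforce
  note IH = Cons.IH[OF tl]
  note ps = partial_sum_less[of _ "length As" _ ?s]
  have D: "diag_block_mat (A # As) = four_block_mat A
      (0\<^sub>m (s 0) (\<Sum>b<length As. ?s b)) (0\<^sub>m (\<Sum>b<length As. ?s b) (s 0)) (diag_block_mat As)"
    using A c by (auto simp: Let_def)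
  show ?case
  proof (cases b)
    case 0
    note b0 = this
    have a: "a < s 0" using 2 0 by simp
    show ?thesis
    proof (cases b')
      case 0
      then show ?thesis using 2 a A c b0 unfolding D by simp
    next
      case (Suc b1')
      have "(\<Sum>c<b1'. ?s c) + a' < (\<Sum>b<length As. ?s b)" using 2 Suc ps by simp
      then show ?thesis using a A c b0 Suc
        by (simp add: D sum.lessThan_Suc_shift[of s] del: sum.lessThan_Suc)
    qed
  next
    case (Suc b1)
    note b1 = this
    have a: "(\<Sum>c<b1. ?s c) + a < (\<Sum>b<length As. ?s b)" using 2 Suc ps by simp
    show ?thesis
    proof (cases b')
      case 0
      then show ?thesis using 2 a A c b1
        by (simp add: D sum.lessThan_Suc_shift[of s] del: sum.lessThan_Suc)
    next
      case (Suc b1')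
      have "(\<Sum>c<b1'. ?s c) + a' < (\<Sum>b<length As. ?s b)" using 2 Suc ps by simp
      then show ?thesis using 2 a A c b1 Suc IH[of b1 b1']

        by (simp add: D sum.lessThan_Suc_shift[of s] del: sum.lessThan_Suc)
    qed
  qed
qed simp

lemma mat_adjoint_carrier [simp]:
  "A \<in> carrier_mat N M \<Longrightarrow> mat_adjoint A \<in> carrier_mat M N"
  by (auto simp: mat_adjoint_def mat_of_rows_def)

lemma mat_adjoint_index [simp]:
  assumes "A \<in> carrier_mat N M" "i < M" "j < N"
  shows "mat_adjoint A $$ (i, j) = cnj (A $$ (j, i))"
  using assms by (auto simp: mat_adjoint_def mat_of_rows_def)

text \<open>
  The list \<open>ks\<close> gives the kinds of the diagonal blocks from top to bottom, one entry for each copy; a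
  block of kind \<open>k\<close> has size \<open>m k\<close>.
\<close>

locale block_sum =
  fixes ks :: "nat list" and m :: "nat \<Rightarrow> nat"
begin

definition offset :: "nat \<Rightarrow> nat" where "offset b = (\<Sum>c<b. m (ks ! c))"

definition N :: nat where "N = offset (length ks)"

definition fam :: "(nat \<Rightarrow> complex mat) set" where
  "fam = {x. \<forall>k. x k \<in> carrier_mat (m k) (m k)}"

definition emb :: "(nat \<Rightarrow> complex mat) \<Rightarrow> complex mat" where
  "emb x = diag_block_mat (map x ks)"

text \<open>
  All copies carry the same block, so \<open>x k\<close> is read off from \<open>emb x\<close> at an arbitrarily chosen one.
\<close>

definition pick :: "nat \<Rightarrow> nat" where
  "pick k = (SOME b. b < length ks \<and> ks ! b = k)"

definition block_at :: "nat \<Rightarrow> complex mat \<Rightarrow> complex mat" where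
  "block_at k X = mat (m k) (m k) (\<lambda>(i, j). X $$ (offset (pick k) + i, offset (pick k) + j))"

lemma famD [simp]: "x \<in> fam \<Longrightarrow> x k \<in> carrier_mat (m k) (m k)"
  by (simp add: fam_def)

lemma fam_dim [simp]: "x \<in> fam \<Longrightarrow> dim_row (x k) = m k" "x \<in> fam \<Longrightarrow> dim_col (x k) = m k"
  using carrier_matD[OF famD[of x k]] by simp_all

lemma offset_less: "b < length ks \<Longrightarrow> a < m (ks ! b) \<Longrightarrow> offset b + a < N"
  unfolding offset_def N_def by (rule partial_sum_less)

lemma offset_cases:
  assumes "i < N"
  obtains b a where "b < length ks" "a < m (ks ! b)" "i = offset b + a"
  using partial_sum_cover[of i "\<lambda>b. m (ks ! b)" "length ks"] assms unfolding offset_def N_def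
  by metis

lemma sum_N:
  fixes g :: "nat \<Rightarrow> 'a :: comm_monoid_add"
  shows "(\<Sum>i<N. g i) = (\<Sum>b<length ks. \<Sum>a<m (ks ! b). g (offset b + a))"
  unfolding offset_def N_def by (rule sum_lessThan_sum)

lemma emb_carrier [simp]: "x \<in> fam \<Longrightarrow> emb x \<in> carrier_mat N N"
  unfolding emb_def N_def offset_def
  using diag_block_mat_carrier[of "map x ks" "\<lambda>b. m (ks ! b)"] by simp

lemma emb_dim [simp]: "x \<in> fam \<Longrightarrow> dim_row (emb x) = N" "x \<in> fam \<Longrightarrow> dim_col (emb x) = N"
  using carrier_matD[OF emb_carrier[of x]] by simp_all

lemma emb_index:
  assumes "x \<in> fam" "b < length ks" "a < m (ks ! b)" "b' < length ks" "a' < m (ks ! b')"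
  shows "emb x $$ (offset b + a, offset b' + a') = (if b = b' then x (ks ! b) $$ (a, a') else 0)"
  unfolding emb_def offset_def
  using diag_block_mat_index[of "map x ks" "\<lambda>b. m (ks ! b)" b a b' a'] assms by simp

lemma emb_eqI:
  assumes "x \<in> fam" "A \<in> carrier_mat N N"
    and "\<And>b a b' a'. \<lbrakk>b < length ks; a < m (ks ! b); b' < length ks; a' < m (ks ! b')\<rbrakk> \<Longrightarrow>
       A $$ (offset b + a, offset b' + a') = (if b = b' then x (ks ! b) $$ (a, a') else 0)"
  shows "A = emb x"
proof (rule eq_matI)
  fix i j assume "i < dim_row (emb x)" "j < dim_col (emb x)"
  then have "i < N" "j < N" using assms by auto
  then show "A $$ (i, j) = emb x $$ (i, j)"
    using assms by (elim offset_cases) (simp add: emb_index)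
qed (use assms in auto)

lemma fam_add [simp]: "x \<in> fam \<Longrightarrow> y \<in> fam \<Longrightarrow> (\<lambda>k. x k + y k) \<in> fam"
  unfolding fam_def by (blast intro: add_carrier_mat)

lemma fam_mult [simp]: "x \<in> fam \<Longrightarrow> y \<in> fam \<Longrightarrow> (\<lambda>k. x k * y k) \<in> fam"
  unfolding fam_def by (blast intro: mult_carrier_mat)

lemma fam_smult [simp]: "x \<in> fam \<Longrightarrow> (\<lambda>k. c \<cdot>\<^sub>m x k) \<in> fam"
  by (simp add: fam_def del: famD)

lemma fam_adjoint [simp]: "x \<in> fam \<Longrightarrow> (\<lambda>k. mat_adjoint (x k)) \<in> fam"
  by (simp add: fam_def del: famD)

lemma fam_one [simp]: "(\<lambda>k. 1\<^sub>m (m k)) \<in> fam"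
  by (simp add: fam_def del: famD)

lemma fam_zero [simp]: "(\<lambda>k. 0\<^sub>m (m k) (m k)) \<in> fam"
  by (simp add: fam_def del: famD)

lemma emb_add: "x \<in> fam \<Longrightarrow> y \<in> fam \<Longrightarrow> emb x + emb y = emb (\<lambda>k. x k + y k)"
  by (rule emb_eqI) (auto simp: emb_index offset_less)

lemma emb_smult: "x \<in> fam \<Longrightarrow> c \<cdot>\<^sub>m emb x = emb (\<lambda>k. c \<cdot>\<^sub>m x k)"
  by (rule emb_eqI) (auto simp: emb_index offset_less)

lemma emb_adjoint: "x \<in> fam \<Longrightarrow> mat_adjoint (emb x) = emb (\<lambda>k. mat_adjoint (x k))"
  by (rule emb_eqI)
    (auto simp: emb_index offset_less mat_adjoint_index[OF emb_carrier]
        mat_adjoint_index[OF famD])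

lemma emb_zero: "0\<^sub>m N N = emb (\<lambda>k. 0\<^sub>m (m k) (m k))"
  by (rule emb_eqI) (auto simp: offset_less)

lemma offset_inj:
  assumes "b < length ks" "a < m (ks ! b)" "b' < length ks" "a' < m (ks ! b')"
  shows "offset b + a = offset b' + a' \<longleftrightarrow> b = b' \<and> a = a'"
proof
  assume eq: "offset b + a = offset b' + a'"
  have *: "offset b' + a' < offset b + a"
    if "b' < b" "a' < m (ks ! b')" for b b' a a'
    using partial_sum_less[of b' b a' "\<lambda>b. m (ks ! b)"] that unfolding offset_def by simp
  show "b = b' \<and> a = a'"
    using *[of b' b a' a] *[of b b' a a'] eq assms by (cases b b' rule: linorder_cases) auto
qed auto

lemma emb_one: "1\<^sub>m N = emb (\<lambda>k. 1\<^sub>m (m k))"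
  by (rule emb_eqI) (auto simp: offset_less offset_inj)

lemma emb_mult:
  assumes "x \<in> fam" "y \<in> fam"
  shows "emb x * emb y = emb (\<lambda>k. x k * y k)"
proof (rule emb_eqI)
  fix b a b' a'
  assume h: "b < length ks" "a < m (ks ! b)" "b' < length ks" "a' < m (ks ! b')"
  have "(emb x * emb y) $$ (offset b + a, offset b' + a') =
    (\<Sum>i<N. emb x $$ (offset b + a, i) * emb y $$ (i, offset b' + a'))"
    using assms h by (simp add: offset_less scalar_prod_def atLeast0LessThan)
  also have "\<dots> = (\<Sum>c<length ks. \<Sum>e<m (ks ! c).
      (if b = c then x (ks ! b) $$ (a, e) else 0) * (if c
          = b' then y (ks ! c) $$ (e, a') else 0))"
    unfolding sum_N using assms h by (intro sum.cong refl) (auto simp: emb_index)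
  also have "\<dots> = (\<Sum>c<length ks. if b = c then (\<Sum>e<m (ks ! b).
      x (ks ! b) $$ (a, e) * (if b = b' then y (ks ! b) $$ (e, a') else 0)) else 0)"
    by (intro sum.cong refl) auto
  also have "\<dots> = (if b = b' then (\<Sum>e<m (ks ! b). x (ks ! b) $$ (a, e) * y (ks ! b) $$ (e, a'))
      else 0)"
    using h by simp
  also have "\<dots> = (if b = b' then (x (ks ! b) * y (ks ! b)) $$ (a, a') else 0)"
    using h assms by (auto simp: scalar_prod_def atLeast0LessThan)
  finally show "(emb x * emb y) $$ (offset b + a, offset b' + a') =
      (if b = b' then (x (ks ! b) * y (ks ! b)) $$ (a, a') else 0)" .
qed (use assms in auto)

lemma pick:
  assumes "k \<in> set ks"
  shows "pick k < length ks" "ks ! pick k = k"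
proof -
  have "\<exists>b. b < length ks \<and> ks ! b = k" using assms by (auto simp: in_set_conv_nth)
  from someI_ex[OF this] show "pick k < length ks" "ks ! pick k = k" by (auto simp: pick_def)
qed

lemma block_at_emb [simp]:
  assumes "x \<in> fam" "k \<in> set ks"
  shows "block_at k (emb x) = x k"
  using assms pick[OF assms(2)] by (intro eq_matI) (auto simp: block_at_def emb_index)

lemma block_at_carrier [simp]: "block_at k X \<in> carrier_mat (m k) (m k)"
  by (simp add: block_at_def)

lemma emb_cong: "(\<And>k. k \<in> set ks \<Longrightarrow> x k = y k) \<Longrightarrow> emb x = emb y"
  by (simp add: emb_def cong: map_cong)

lemma sesq_emb:
  assumes "x \<in> fam"
  shows "sesq N (emb x) u v =
    (\<Sum>b<length ks. sesq (m (ks ! b)) (x (ks ! b)) (\<lambda>a. u (offset b + a)) (\<lambda>a. v (offset b + a)))"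
proof -
  have "sesq N (emb x) u v =
    (\<Sum>b<length ks. \<Sum>a<m (ks ! b). \<Sum>c<length ks. \<Sum>e<m (ks ! c).
      cnj (u (offset b + a)) * (if b = c then x (ks ! b) $$ (a, e) else 0) * v (offset c + e))"
    unfolding sesq_def sum_N using assms by (intro sum.cong refl) (auto simp: emb_index)
  also have "\<dots> = (\<Sum>b<length ks. \<Sum>a<m (ks ! b). \<Sum>c<length ks.
      if b = c
      then (\<Sum>e<m (ks ! b). cnj (u (offset b + a)) * x (ks ! b) $$ (a, e) * v (offset b + e))
      else 0)"
    by (rule sum.cong[OF refl], rule sum.cong[OF refl], rule sum.cong[OF refl]) auto
  also have "\<dots> = (\<Sum>b<length ks. sesq (m (ks ! b)) (x (ks ! b)) (\<lambda>a. u (offset b + a))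
      (\<lambda>a. v (offset b + a)))"
    unfolding sesq_def by (rule sum.cong[OF refl]) simp
  finally show ?thesis .
qed

lemma block_fnorm_N:
  "block_fnorm p N u = L2_set (\<lambda>b. block_fnorm p (m (ks ! b)) (\<lambda>i a. u i (offset b + a)))
      {..<length ks}"
proof (rule power2_eq_imp_eq)
  have "(block_fnorm p N u)\<^sup>2
      = (\<Sum>i<p. \<Sum>b<length ks. (fnorm (m (ks ! b)) (\<lambda>a. u i (offset b + a)))\<^sup>2)"
    unfolding block_fnorm_power2 fnorm_power2 by (simp add: sum_N)
  also have "\<dots> = (\<Sum>b<length ks. \<Sum>i<p. (fnorm (m (ks ! b)) (\<lambda>a. u i (offset b + a)))\<^sup>2)"
    by (rule sum.swap)
  also have "\<dots> = (L2_set (\<lambda>b. block_fnorm p (m (ks ! b)) (\<lambda>i a. u i (offset b + a)))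
      {..<length ks})\<^sup>2"
    unfolding L2_set_def by (simp add: sum_nonneg block_fnorm_power2)
  finally show "(block_fnorm p N u)\<^sup>2 =
    (L2_set (\<lambda>b. block_fnorm p (m (ks ! b)) (\<lambda>i a. u i (offset b + a))) {..<length ks})\<^sup>2" .
qed auto

lemma block_sesq_emb:
  assumes "\<And>i j. i < p \<Longrightarrow> j < p \<Longrightarrow> X i j = emb (x i j) \<and> x i j \<in> fam"
  shows "block_sesq p N X u v =
    (\<Sum>b<length ks. block_sesq p (m (ks ! b)) (\<lambda>i j. x i j (ks ! b))
       (\<lambda>i a. u i (offset b + a)) (\<lambda>i a. v i (offset b + a)))"
proof -
  have "block_sesq p N X u v = (\<Sum>i<p. \<Sum>j<p. \<Sum>b<length ks. sesq (m (ks ! b)) (x i j (ks ! b))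
      (\<lambda>a. u i (offset b + a)) (\<lambda>a. v j (offset b + a)))"
    unfolding block_sesq_def using assms by (intro sum.cong refl) (auto simp: sesq_emb)
  also have "\<dots> = (\<Sum>i<p. \<Sum>b<length ks. \<Sum>j<p. sesq (m (ks ! b)) (x i j (ks ! b))
      (\<lambda>a. u i (offset b + a)) (\<lambda>a. v j (offset b + a)))"
    by (rule sum.cong[OF refl], rule sum.swap)
  also have "\<dots> = (\<Sum>b<length ks. \<Sum>i<p. \<Sum>j<p. sesq (m (ks ! b)) (x i j (ks ! b))
      (\<lambda>a. u i (offset b + a)) (\<lambda>a. v j (offset b + a)))"
    by (rule sum.swap)
  finally show ?thesis by (simp add: block_sesq_def)
qed

text \<open>
  The form of a block diagonal matrix is the sum of the forms of its blocks, so that the bounds for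
  the blocks add up by the Cauchy-Schwarz inequality.
\<close>

lemma block_sesq_emb_le:
  assumes X: "\<And>i j. i < p \<Longrightarrow> j < p \<Longrightarrow> X i j = emb (x i j) \<and> x i j \<in> fam"
    and c: "0 \<le> c"
    and bd: "\<And>k u v. k \<in> set ks \<Longrightarrow>
       cmod (block_sesq p (m k) (\<lambda>i j. x i j k) u v)
           \<le> c * block_fnorm p (m k) u * block_fnorm p (m k) v"
  shows "cmod (block_sesq p N X u v) \<le> c * block_fnorm p N u * block_fnorm p N v"
proof -
  let ?n = "\<lambda>u b. block_fnorm p (m (ks ! b)) (\<lambda>i a. u i (offset b + a) :: complex)"
  have "cmod (block_sesq p N X u v) \<le> (\<Sum>b<length ks. cmod (block_sesq p (m (ks ! b))
      (\<lambda>i j. x i j (ks ! b)) (\<lambda>i a. u i (offset b + a)) (\<lambda>i a. v i (offset b + a))))"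
    by (subst block_sesq_emb[of p X x], rule X, assumption+, rule norm_sum)
  also have "\<dots> \<le> (\<Sum>b<length ks. c * ?n u b * ?n v b)"
    by (intro sum_mono bd) auto
  also have "\<dots> = c * (\<Sum>b<length ks. \<bar>?n u b\<bar> * \<bar>?n v b\<bar>)"
    by (simp add: sum_distrib_left mult.assoc)
  also have "\<dots> \<le> c * (L2_set (?n u) {..<length ks} * L2_set (?n v) {..<length ks})"
    using c by (intro mult_left_mono L2_set_mult_ineq)
  finally show ?thesis by (simp add: block_fnorm_N mult.assoc)
qed

definition extend_vec :: "nat \<Rightarrow> (nat \<Rightarrow> complex) \<Rightarrow> nat \<Rightarrow> complex" where
  "extend_vec b u =
     (\<lambda>i. if offset b \<le> i \<and> i < offset b + m (ks ! b) then u (i - offset b) else 0)"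

lemma extend_vec_offset:
  assumes "b < length ks" "a < m (ks ! b)" "b' < length ks"
  shows "extend_vec b' u (offset b + a) = (if b = b' then u a else 0)"
proof -
  have "offset b' \<le> offset b + a \<and> offset b + a < offset b' + m (ks ! b') \<longleftrightarrow> b = b'" (is "?l = _")
  proof
    assume ?l
    then obtain a' where "offset b + a = offset b' + a'" "a' < m (ks ! b')"
      by (metis add_less_cancel_left le_Suc_ex)
    then show "b = b'" using offset_inj assms by metis
  qed (use assms in auto)
  then show ?thesis unfolding extend_vec_def using assms by auto
qed

lemma fnorm_extend_vec:
  assumes "b < length ks"
  shows "fnorm N (extend_vec b u) = fnorm (m (ks ! b)) u"
proof (rule power2_eq_imp_eq)
  have "(fnorm N (extend_vec b u))\<^sup>2
      = (\<Sum>c<length ks. \<Sum>a<m (ks ! c). (cmod (if c = b then u a else 0))\<^sup>2)"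
    unfolding fnorm_power2 sum_N using assms
    by (intro sum.cong refl) (simp add: extend_vec_offset)
  also have "\<dots> = (\<Sum>c<length ks. if c = b then (\<Sum>a<m (ks ! b). (cmod (u a))\<^sup>2) else 0)"
    by (intro sum.cong refl) auto
  also have "\<dots> = (fnorm (m (ks ! b)) u)\<^sup>2" using assms by (simp add: fnorm_power2)
  finally show "(fnorm N (extend_vec b u))\<^sup>2 = (fnorm (m (ks ! b)) u)\<^sup>2" .
qed auto

lemma sesq_extend_vec:
  assumes "b < length ks" "x \<in> fam"
  shows "sesq N (emb x) (extend_vec b u) (extend_vec b v) = sesq (m (ks ! b)) (x (ks ! b)) u v"
proof -
  have "sesq N (emb x) (extend_vec b u) (extend_vec b v) =
    (\<Sum>c<length ks. if c = b then sesq (m (ks ! b)) (x (ks ! b)) u v else 0)"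
    unfolding sesq_emb[OF assms(2)] using assms
    by (intro sum.cong refl) (auto simp: sesq_def extend_vec_offset)
  then show ?thesis using assms by simp
qed

text \<open>
  Conversely each block is the compression of the whole matrix to one of the copies.
\<close>

lemma block_sesq_le_of_emb:
  assumes X: "\<And>i j. i < p \<Longrightarrow> j < p \<Longrightarrow> X i j = emb (x i j) \<and> x i j \<in> fam"
    and k: "k \<in> set ks"
  shows "cmod (block_sesq p (m k) (\<lambda>i j. x i j k) u v)
    \<le> op_norm (block_mat p N X) * block_fnorm p (m k) u * block_fnorm p (m k) v"
proof -
  obtain b where b: "b < length ks" "ks ! b = k" using k by (auto simp: in_set_conv_nth)
  have "block_sesq p (m k) (\<lambda>i j. x i j k) u v = block_sesq p N X (\<lambda>i. extend_vec b (u i))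
      (\<lambda>i. extend_vec b (v i))"
    unfolding block_sesq_def using X b by (intro sum.cong refl) (auto simp: sesq_extend_vec)
  moreover have "block_fnorm p N (\<lambda>i. extend_vec b (u i)) = block_fnorm p (m k) u" for u
    unfolding block_fnorm_def using b by (simp add: fnorm_extend_vec)
  ultimately show ?thesis using block_sesq_le_op_norm[of p N X] by metis
qed

end

section \<open>The generated C*-algebra\<close>

definition mat_unit :: "nat \<Rightarrow> nat \<Rightarrow> nat \<Rightarrow> complex mat" where
  "mat_unit n i j = mat n n (\<lambda>(a, b). if a = i \<and> b = j then 1 else 0)"

lemma mat_unit_carrier [simp]: "mat_unit n i j \<in> carrier_mat n n"
  by (simp add: mat_unit_def)

lemma mult_index_sum:
  assumes "A \<in> carrier_mat n n" "B \<in> carrier_mat n n" "i < n" "j < n"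
  shows "(A * B) $$ (i, j) = (\<Sum>e<n. A $$ (i, e) * B $$ (e, j))"
  using assms by (simp add: scalar_prod_def atLeast0LessThan)

lemma mat_unit_mult:
  assumes "B \<in> carrier_mat n n" "j < n"
  shows "mat_unit n i j * B = mat n n (\<lambda>(a, b). if a = i then B $$ (j, b) else 0)"
proof (rule eq_matI)
  fix a b assume "a < dim_row (mat n n (\<lambda>(a, b). if a = i then B $$ (j, b) else 0))"
    "b < dim_col (mat n n (\<lambda>(a, b). if a = i then B $$ (j, b) else 0))"
  then have ab: "a < n" "b < n" by auto
  have "(mat_unit n i j * B) $$ (a, b)
      = (\<Sum>e<n. if e = j then (if a = i then B $$ (j, b) else 0) else 0)"
    unfolding mult_index_sum[OF mat_unit_carrier assms(1) ab]
    using ab by (intro sum.cong refl) (auto simp: mat_unit_def)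
  then show "(mat_unit n i j * B) $$ (a, b)
      = mat n n (\<lambda>(a, b). if a = i then B $$ (j, b) else 0) $$ (a, b)"
    using ab assms by simp
qed (use assms in \<open>auto simp: mat_unit_def\<close>)

lemma mult_mat_unit:
  assumes "A \<in> carrier_mat n n" "i < n"
  shows "A * mat_unit n i j = mat n n (\<lambda>(a, b). if b = j then A $$ (a, i) else 0)"
proof (rule eq_matI)
  fix a b assume "a < dim_row (mat n n (\<lambda>(a, b). if b = j then A $$ (a, i) else 0))"
    "b < dim_col (mat n n (\<lambda>(a, b). if b = j then A $$ (a, i) else 0))"
  then have ab: "a < n" "b < n" by auto
  have "(A * mat_unit n i j) $$ (a, b)
      = (\<Sum>e<n. if e = i then (if b = j then A $$ (a, i) else 0) else 0)"
    unfolding mult_index_sum[OF assms(1) mat_unit_carrier ab]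
    using ab by (intro sum.cong refl) (auto simp: mat_unit_def)
  then show "(A * mat_unit n i j) $$ (a, b)
      = mat n n (\<lambda>(a, b). if b = j then A $$ (a, i) else 0) $$ (a, b)"
    using ab assms by simp
qed (use assms in \<open>auto simp: mat_unit_def\<close>)

lemma jordan_block_zero_pow_size: "jordan_block n (0 :: complex) ^\<^sub>m n = 0\<^sub>m n n"
  unfolding jordan_block_zero_pow by (intro eq_matI) auto

lemma jordan_block_zero_pow_pred:
  assumes "1 \<le> n"
  shows "jordan_block n (0 :: complex) ^\<^sub>m (n - 1) = mat_unit n 0 (n - 1)"
  unfolding jordan_block_zero_pow mat_unit_def using assms by (intro eq_matI) auto

text \<open>
  The last row of a Jordan block is its eigenvalue times the last unit row.
\<close>

lemma mat_unit_jordan_block_pow: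
  assumes "1 \<le> n"
  shows "mat_unit n 0 (n - 1) * jordan_block n c ^\<^sub>m r = c ^ r \<cdot>\<^sub>m mat_unit n 0 (n - 1)"
proof (induction r)
  case 0
  show ?case using assms by (auto simp: mat_unit_def)
next
  case (Suc r)
  let ?E = "mat_unit n 0 (n - 1)" and ?J = "jordan_block n c"
  have E: "?E * ?J = c \<cdot>\<^sub>m ?E"
    using assms by (subst mat_unit_mult) (auto simp: mat_unit_def intro!: eq_matI)
  have "?E * ?J ^\<^sub>m Suc r = (?E * ?J ^\<^sub>m r) * ?J"
    by (simp add: assoc_mult_mat[of _ n n _ n _ n])
  also have "\<dots> = c ^ r \<cdot>\<^sub>m (?E * ?J)" unfolding Suc
    by (rule mult_smult_assoc_mat[of _ n n _ n]) auto
  also have "\<dots> = c ^ Suc r \<cdot>\<^sub>m ?E" unfolding E by (auto intro!: eq_matI)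
  finally show ?case .
qed

lemma adjoint_jordan_block_index:
  "a < n \<Longrightarrow> b < n \<Longrightarrow> mat_adjoint (jordan_block n (0 :: complex)) $$ (a, b)
      = (if a = Suc b then 1 else 0)"
  by (subst mat_adjoint_index[OF jordan_block_carrier]) auto

lemma adjoint_shift_mat_unit:
  assumes "Suc i < n"
  shows "mat_adjoint (jordan_block n 0) * mat_unit n i j = mat_unit n (Suc i) j"
  using assms by (subst mult_mat_unit)
      (auto simp: adjoint_jordan_block_index mat_unit_def intro!: eq_matI)

lemma mat_unit_adjoint_shift:
  assumes "Suc j < n"
  shows "mat_unit n i (Suc j) * mat_adjoint (jordan_block n 0) = mat_unit n i j"
  using assms by (subst mat_unit_mult)
      (auto simp: adjoint_jordan_block_index mat_unit_def intro!: eq_matI)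

context block_sum
begin

definition single :: "nat \<Rightarrow> complex mat \<Rightarrow> nat \<Rightarrow> complex mat" where
  "single f z = (\<lambda>k. if k = f then z else 0\<^sub>m (m k) (m k))"

lemma single_fam [simp]: "z \<in> carrier_mat (m f) (m f) \<Longrightarrow> single f z \<in> fam"
  by (auto simp: fam_def single_def simp del: famD)

definition block_ideal :: "nat set \<Rightarrow> complex mat set" where
  "block_ideal F = emb ` {x \<in> fam. \<forall>k\<in>F. x k = 0\<^sub>m (m k) (m k)}"

text \<open>
  Membership is a system of linear equations between entries: entries off the diagonal blocks
  vanish, copies of the same block agree, and the blocks in \<open>F\<close> vanish.  Such equations survive
  limits.
\<close>

lemma norm_closed_block_ideal: "norm_closed N (block_ideal F)"
  unfolding norm_closed_def
proof (intro allI impI, elim conjE)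
  fix X :: "nat \<Rightarrow> complex mat" and A
  assume X: "\<forall>i. X i \<in> block_ideal F" and A: "A \<in> carrier_mat N N"
    and lim: "(\<lambda>i. op_norm (X i - A)) \<longlonglongrightarrow> 0"
  obtain x where x: "\<And>i. X i = emb (x i)" "\<And>i. x i \<in> fam" "\<And>i k. k \<in> F \<Longrightarrow> x i k = 0\<^sub>m (m k) (m k)"
  proof -
    have "\<forall>i. \<exists>x. X i = emb x \<and> x \<in> fam \<and> (\<forall>k\<in>F. x k = 0\<^sub>m (m k) (m k))"
      using X by (auto simp: block_ideal_def)
    then show ?thesis using that by metis
  qed
  have entry: "(\<lambda>i. X i $$ (r, c)) \<longlonglongrightarrow> A $$ (r, c)" if "r < N" "c < N" for r c
  proof -
    have "(\<lambda>i. X i $$ (r, c) - A $$ (r, c)) \<longlonglongrightarrow> 0"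
    proof (rule tendsto_0_le[OF lim, of _ 1])
      show "\<forall>\<^sub>F i in sequentially. cmod (X i $$ (r, c) - A $$ (r, c))
          \<le> norm (op_norm (X i - A)) * 1"
      proof (rule always_eventually, rule allI)
        fix i
        show "cmod (X i $$ (r, c) - A $$ (r, c)) \<le> norm (op_norm (X i - A)) * 1"
          using cmod_entry_le_op_norm[of "X i - A" N r c] that A
          by (simp add: x minus_carrier_mat)
      qed
    qed
    then show ?thesis by (rule LIM_zero_cancel)
  qed
  let ?y = "\<lambda>k. if k \<in> F then 0\<^sub>m (m k) (m k) else block_at k A"
  have y: "?y \<in> fam" by (simp add: fam_def del: famD)
  have "A = emb ?y"
  proof (rule emb_eqI[OF y A])
    fix b a b' a'
    assume h: "b < length ks" "a < m (ks ! b)" "b' < length ks" "a' < m (ks ! b')"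
    let ?k = "ks ! b"
    have e: "(\<lambda>i. if b = b' then x i ?k $$ (a, a') else 0) \<longlonglongrightarrow> A $$ (offset b + a, offset b' + a')"
      using entry[of "offset b + a" "offset b' + a'"] h by (simp add: offset_less x emb_index)
    show "A $$ (offset b + a, offset b' + a') = (if b = b' then ?y ?k $$ (a, a') else 0)"
    proof (cases "b = b'")
      case False
      then have "(\<lambda>i. 0) \<longlonglongrightarrow> A $$ (offset b + a, offset b' + a')" using e by simp
      then show ?thesis unfolding if_not_P[OF False] by (rule LIMSEQ_unique) (rule tendsto_const)
    next
      case True
      note bb = this
      show ?thesis
      proof (cases "?k \<in> F")
        case True
        then have "(\<lambda>i. 0) \<longlonglongrightarrow> A $$ (offset b + a, offset b' + a')"
          using e h(2) h(4)[folded bb] unfolding if_P[OF bb] x(3)[OF True] by simp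
        then have "A $$ (offset b + a, offset b' + a') = 0"
          by (rule LIMSEQ_unique) (rule tendsto_const)
        then show ?thesis using True h bb by simp
      next
        case False
        have k: "?k \<in> set ks" using h by simp
        have "(\<lambda>i. x i ?k $$ (a, a')) \<longlonglongrightarrow> A $$ (offset (pick ?k) + a, offset (pick ?k) + a')"
          using entry[of "offset (pick ?k) + a" "offset (pick ?k) + a'"] h bb pick[OF k]
          by (simp add: offset_less x emb_index)
        then have "A $$ (offset b + a, offset b' + a')
            = A $$ (offset (pick ?k) + a, offset (pick ?k) + a')"
          using e unfolding if_P[OF bb] by (intro LIMSEQ_unique)
        then show ?thesis using False bb h by (simp add: block_at_def)
      qed
    qed
  qed
  moreover have "?y \<in> {x \<in> fam. \<forall>k\<in>F. x k = 0\<^sub>m (m k) (m k)}" using y by simp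
  ultimately show "A \<in> block_ideal F" unfolding block_ideal_def by (rule image_eqI)
qed

lemma block_ideal_empty: "block_ideal {} = emb ` fam"
  by (auto simp: block_ideal_def)

lemma unital_cstar_subalgebra_emb: "unital_cstar_subalgebra N (emb ` fam)"
  unfolding unital_cstar_subalgebra_def
proof (intro conjI ballI allI)
  show "norm_closed N (emb ` fam)" using norm_closed_block_ideal[of "{}"]
    by (simp add: block_ideal_empty)
  show "1\<^sub>m N \<in> emb ` fam" unfolding emb_one by (rule imageI) simp
  fix X Y c assume "X \<in> emb ` fam"
  then obtain x where x: "x \<in> fam" "X = emb x" by auto
  show "c \<cdot>\<^sub>m X \<in> emb ` fam" "mat_adjoint X \<in> emb ` fam"
    using x by (auto simp: emb_smult emb_adjoint)
  assume "Y \<in> emb ` fam"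
  then obtain y where y: "y \<in> fam" "Y = emb y" by auto
  show "X + Y \<in> emb ` fam" "X * Y \<in> emb ` fam"
    using x y by (auto simp: emb_add emb_mult)
qed auto

end

locale jordan_blocks = block_sum +
  fixes l :: "nat \<Rightarrow> real"
  assumes m_pos: "k \<in> set ks \<Longrightarrow> 1 \<le> m k"
    and l_inj: "inj_on l (set ks)"
begin

definition jblock :: "nat \<Rightarrow> complex mat" where
  "jblock k = jordan_block (m k) (complex_of_real (l k))"

definition T :: "complex mat" where
  "T = jordan_matrix (map (\<lambda>k. (m k, complex_of_real (l k))) ks)"

lemma jblock_fam [simp]: "jblock \<in> fam"
  by (simp add: fam_def jblock_def del: famD)

lemma T_eq: "T = emb jblock"
  by (simp add: T_def emb_def jordan_matrix_def jblock_def[abs_def] o_def)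

lemma dim_T [simp]: "dim_row T = N"
  by (simp add: T_eq)

text \<open>
  The \<open>k\<close>-th block of \<open>a + b T + c T*\<close>.
\<close>

definition os_block :: "complex \<Rightarrow> complex \<Rightarrow> complex \<Rightarrow> nat \<Rightarrow> complex mat" where
  "os_block a b c = (\<lambda>k. a \<cdot>\<^sub>m 1\<^sub>m (m k) + b \<cdot>\<^sub>m jblock k + c \<cdot>\<^sub>m mat_adjoint (jblock k))"

lemma os_block_fam [simp]: "os_block a b c \<in> fam"
  unfolding os_block_def by (intro fam_add fam_smult fam_adjoint fam_one jblock_fam)

lemma op_system_eq: "op_system T = {emb (os_block a b c) | a b c. True}"
  by (simp add: op_system_def emb_one T_eq emb_smult emb_add emb_adjoint os_block_def)

text \<open>
  Here the distinctness of the eigenvalues enters: it makes it possible to cut out the corner matrix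
  unit of a single block by a polynomial in \<open>T\<close>.
\<close>

lemma emb_in_cstar_subalgebra:
  assumes B: "unital_cstar_subalgebra N B" and T: "op_system T \<subseteq> B"
  shows "emb ` fam \<subseteq> B"
proof -
  define P where "P x \<longleftrightarrow> x \<in> fam \<and> emb x \<in> B" for x
  have P_add: "P (\<lambda>k. x k + y k)" and P_mult: "P (\<lambda>k. x k * y k)" if "P x" "P y" for x y
    using that B by (auto simp: P_def unital_cstar_subalgebra_def emb_add[symmetric]
        emb_mult[symmetric])
  have P_smult: "P (\<lambda>k. c \<cdot>\<^sub>m x k)" and P_adj: "P (\<lambda>k. mat_adjoint (x k))" if "P x" for x c
    using that B by (auto simp: P_def unital_cstar_subalgebra_def emb_smult[symmetric]
        emb_adjoint[symmetric])
  have P_one: "P (\<lambda>k. 1\<^sub>m (m k))"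
    using B by (auto simp: P_def unital_cstar_subalgebra_def emb_one[symmetric])
  have P_cong: "P y" if "P x" "y \<in> fam" "\<And>k. k \<in> set ks \<Longrightarrow> x k = y k" for x y
    using that emb_cong[of x y] by (auto simp: P_def)
  define s where "s \<mu> k = jordan_block (m k) (complex_of_real (l k - \<mu>))" for \<mu> k
  have P_s: "P (s \<mu>)" for \<mu>
  proof -
    have "s \<mu> k = os_block (- complex_of_real \<mu>) 1 0 k" for k
      unfolding s_def os_block_def jblock_def
      by (rule eq_matI)
        (auto simp: carrier_matD[OF mat_adjoint_carrier[OF jordan_block_carrier]])
    then have "s \<mu> = os_block (- complex_of_real \<mu>) 1 0" by blast
    moreover have "emb (os_block (- complex_of_real \<mu>) 1 0) \<in> B" using T unfolding op_system_eq
      by blast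
    ultimately show ?thesis by (simp add: P_def)
  qed
  have P_pow: "P (\<lambda>k. s \<mu> k ^\<^sub>m r)" for \<mu> r
  proof (induction r)
    case 0
    then show ?case using P_one by (simp add: s_def)
  next
    case (Suc r)
    then show ?case using P_mult[OF Suc P_s] by simp
  qed
  \<comment> \<open>The power \<open>(T - l f)^(m f - 1)\<close> has the corner unit as its block \<open>f\<close>.  A factor \<open>(T - l j)^(m j)\<close>
    kills block \<open>j\<close> and multiplies that corner unit by \<open>(l f - l j)^(m j) \<noteq> 0\<close>.\<close>
  have corner: "P (single f (mat_unit (m f) 0 (m f - 1)))" if f: "f \<in> set ks" for f
  proof -
    let ?E = "mat_unit (m f) 0 (m f - 1)"
    have "\<exists>y c. P y \<and> c \<noteq> 0 \<and> y f = c \<cdot>\<^sub>m ?E \<and> (\<forall>k\<in>G. y k = 0\<^sub>m (m k) (m k))"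
      if "finite G" "G \<subseteq> set ks - {f}" for G
      using that
    proof (induction G)
      case empty
      have "s (l f) f ^\<^sub>m (m f - 1) = 1 \<cdot>\<^sub>m ?E"
        unfolding s_def using jordan_block_zero_pow_pred[OF m_pos[OF f]]
        by (auto intro!: eq_matI)
      then show ?case using P_pow
        by (intro exI[of _ "\<lambda>k. s (l f) k ^\<^sub>m (m f - 1)"] exI[of _ 1]) auto
    next
      case (insert j G)
      then obtain y c where y: "P y" "c \<noteq> 0" "y f = c \<cdot>\<^sub>m ?E" "\<forall>k\<in>G. y k = 0\<^sub>m (m k) (m k)"
        by auto
      have j: "j \<in> set ks" "j \<noteq> f" using insert by auto
      let ?d = "complex_of_real (l f - l j)"
      let ?y = "\<lambda>k. y k * s (l j) k ^\<^sub>m m j"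
      have "l f \<noteq> l j" using l_inj f j by (auto simp: inj_on_def)
      then have d: "?d \<noteq> 0" by simp
      have yf: "y k \<in> carrier_mat (m k) (m k)" for k using y(1) by (simp add: P_def)
      have sc: "s (l j) k ^\<^sub>m m j \<in> carrier_mat (m k) (m k)" for k by (simp add: s_def)
      have "?y f = c \<cdot>\<^sub>m (?E * s (l j) f ^\<^sub>m m j)"
        unfolding y(3) using sc[of f]
        by (intro mult_smult_assoc_mat[of _ "m f" "m f" _ "m f"]) auto
      also have "\<dots> = (c * ?d ^ m j) \<cdot>\<^sub>m ?E"
        unfolding s_def mat_unit_jordan_block_pow[OF m_pos[OF f]] by (auto intro!: eq_matI)
      finally have 1: "?y f = (c * ?d ^ m j) \<cdot>\<^sub>m ?E" .
      have "?y j = y j * 0\<^sub>m (m j) (m j)" using jordan_block_zero_pow_size[of "m j"]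
        by (simp add: s_def)
      then have 2: "?y j = 0\<^sub>m (m j) (m j)" using right_mult_zero_mat[OF yf[of j]] by simp
      have 3: "?y k = 0\<^sub>m (m k) (m k)" if "k \<in> G" for k
        using y(4) that left_mult_zero_mat[OF sc[of k]] by simp
      have "P ?y" using P_mult[OF y(1) P_pow] .
      then show ?case using 1 2 3 d y(2) by (intro exI[of _ ?y] exI[of _ "c * ?d ^ m j"]) auto
    qed
    from this[of "set ks - {f}"] obtain y c where
      y: "P y" "c \<noteq> 0" "y f = c \<cdot>\<^sub>m ?E" "\<forall>k\<in>set ks - {f}. y k = 0\<^sub>m (m k) (m k)" by auto
    have "(1 / c) \<cdot>\<^sub>m y k = single f ?E k" if "k \<in> set ks" for k
      using y that by (auto simp: single_def intro!: eq_matI)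
    then show ?thesis using P_cong[OF P_smult[OF y(1), of "1 / c"]] by simp
  qed
  have sf: "s (l f) f = jordan_block (m f) 0" for f by (simp add: s_def)
  \<comment> \<open>On block \<open>f\<close> the matrix \<open>T* - l f\<close> is the backward shift: from the left it moves matrix units one row
    down, from the right one column to the left.\<close>
  have unit: "P (single f (mat_unit (m f) i j))" if f: "f \<in> set ks" and ij: "i < m f" "j < m f"
    for f i j
  proof -
    have s_carrier: "mat_adjoint (s (l f) k) \<in> carrier_mat (m k) (m k)" for k by (simp add: s_def)
    have col: "P (single f (mat_unit (m f) i (m f - 1)))" if "i < m f" for i
      using that
    proof (induction i)
      case (Suc i)
      have "(\<lambda>k. mat_adjoint (s (l f) k) * single f (mat_unit (m f) i (m f - 1)) k)
          = single f (mat_unit (m f) (Suc i) (m f - 1))"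
        using Suc.prems s_carrier
        by (auto simp: single_def sf adjoint_shift_mat_unit intro!: ext right_mult_zero_mat)
      then show ?case using P_mult[OF P_adj[OF P_s] Suc.IH, of "l f"] Suc.prems by simp
    qed (use corner f in auto)
    have "P (single f (mat_unit (m f) i (m f - 1 - r)))" if "r \<le> m f - 1" for r
      using that
    proof (induction r)
      case (Suc r)
      have eq: "m f - 1 - r = Suc (m f - 1 - Suc r)" using Suc.prems by simp
      have "(\<lambda>k. single f (mat_unit (m f) i (m f - 1 - r)) k * mat_adjoint (s (l f) k))
          = single f (mat_unit (m f) i (m f - 1 - Suc r))"
        using Suc.prems s_carrier unfolding eq
        by (auto simp: single_def sf mat_unit_adjoint_shift intro!: ext left_mult_zero_mat)
      then show ?case using P_mult[OF Suc.IH P_adj[OF P_s], of "l f"] Suc.prems by simp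
    qed (use col ij in auto)
    from this[of "m f - 1 - j"] ij show ?thesis by simp
  qed
  show ?thesis
  proof
    fix X assume "X \<in> emb ` fam"
    then obtain x where x: "x \<in> fam" and X: "X = emb x" by auto
    let ?I = "SIGMA k:set ks. {..<m k} \<times> {..<m k}"
    let ?x = "\<lambda>G k. mat (m k) (m k) (\<lambda>(i, j). if (k, i, j) \<in> G then x k $$ (i, j) else 0)"
    \<comment> \<open>Any element is a linear combination of the matrix units; they are added one at a time.\<close>
    have fin: "P (?x G)" if "finite G" "G \<subseteq> ?I" for G
      using that
    proof (induction G)
      case empty
      have "P (\<lambda>k. 0 \<cdot>\<^sub>m 1\<^sub>m (m k))" by (rule P_smult[OF P_one])
      also have "(\<lambda>k. 0 \<cdot>\<^sub>m 1\<^sub>m (m k)) = ?x {}" by (auto intro!: eq_matI)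
      finally show ?case .
    next
      case (insert t G)
      obtain f i j where t: "t = (f, i, j)" by (cases t)
      have h: "f \<in> set ks" "i < m f" "j < m f" using insert t by auto
      have eq: "(\<lambda>k. ?x G k + x f $$ (i, j) \<cdot>\<^sub>m single f (mat_unit (m f) i j) k)
          = ?x (insert t G)"
        using insert.hyps(2) unfolding t
        by (intro ext eq_matI) (auto simp: single_def mat_unit_def)
      have "P (?x G)" by (rule insert.IH) (use insert.prems in blast)
      from P_add[OF this P_smult[OF unit[OF h]]] show ?case unfolding eq[symmetric] .
    qed
    have "finite ?I" by (intro finite_SigmaI finite_cartesian_product) auto
    from fin[OF this order_refl] have "P (?x ?I)" .
    moreover have "emb (?x ?I) = emb x"
      using x by (intro emb_cong) (auto intro!: eq_matI)
    ultimately show "X \<in> B" by (simp add: X P_def)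
  qed
qed

lemma cstar_gen_eq: "cstar_gen T = sub_mat_alg N (emb ` fam)"
proof -
  have "op_system T \<subseteq> emb ` fam" by (auto simp: op_system_eq)
  then have "\<Inter>{A. unital_cstar_subalgebra N A \<and> op_system T \<subseteq> A} = emb ` fam"
    using emb_in_cstar_subalgebra unital_cstar_subalgebra_emb by blast
  then show ?thesis by (simp add: cstar_gen_def)
qed

end

section \<open>*-homomorphisms and quotients\<close>

definition star_hom :: "'a star_alg \<Rightarrow> 'b star_alg \<Rightarrow> ('a \<Rightarrow> 'b) \<Rightarrow> bool" where
  "star_hom A B h \<longleftrightarrow> h \<in> ring_hom A B \<and>
     (\<forall>x \<in> carrier A. (\<forall>c. h (c \<odot>\<^bsub>A\<^esub> x) = c \<odot>\<^bsub>B\<^esub> h x) \<and> h (adj A x) = adj B (h x))"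

lemma star_hom_ring_hom: "star_hom A B h \<Longrightarrow> h \<in> ring_hom A B"
  by (simp add: star_hom_def)

lemma star_isomorphic_iff:
  "star_isomorphic A B \<longleftrightarrow> (\<exists>\<phi>. star_hom A B \<phi> \<and> bij_betw \<phi> (carrier A) (carrier B))"
  unfolding star_isomorphic_def star_hom_def ring_iso_def by blast

lemma star_hom_compose:
  assumes "star_hom A B h" "star_hom B C g"
  shows "star_hom A C (\<lambda>x. g (h x))"
  using assms unfolding star_hom_def ring_hom_def by (auto simp: Pi_iff)

lemma star_hom_Pair:
  assumes "star_hom A B h" "star_hom A C g"
  shows "star_hom A (dsum_alg B C) (\<lambda>x. (h x, g x))"
  using assms unfolding star_hom_def ring_hom_def dsum_alg_def by (auto simp: Pi_iff)

lemma ring_dsum_alg: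
  assumes "ring A" "ring B"
  shows "ring (dsum_alg A B)"
proof -
  interpret A: ring A by fact
  interpret B: ring B by fact
  show ?thesis
  proof (rule ringI)
    show "abelian_group (dsum_alg A B)"
    proof (rule abelian_groupI)
      fix x assume "x \<in> carrier (dsum_alg A B)"
      then show "\<exists>y\<in>carrier (dsum_alg A B). y \<oplus>\<^bsub>dsum_alg A B\<^esub> x = \<zero>\<^bsub>dsum_alg A B\<^esub>"
        by (intro bexI[of _ "(\<ominus>\<^bsub>A\<^esub> fst x, \<ominus>\<^bsub>B\<^esub> snd x)"]) (auto simp: dsum_alg_def A.l_neg B.l_neg)
    qed (auto simp: dsum_alg_def A.a_assoc B.a_assoc intro: A.a_comm B.a_comm)
    show "monoid (dsum_alg A B)"
      by (rule monoidI) (auto simp: dsum_alg_def A.m_assoc B.m_assoc)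
  qed (auto simp: dsum_alg_def A.l_distr B.l_distr A.r_distr B.r_distr)
qed

lemma ring_complex_alg: "ring complex_alg"
proof (rule ringI)
  show "abelian_group complex_alg"
  proof (rule abelian_groupI)
    fix x assume "x \<in> carrier complex_alg"
    show "\<exists>y\<in>carrier complex_alg. y \<oplus>\<^bsub>complex_alg\<^esub> x = \<zero>\<^bsub>complex_alg\<^esub>"
      by (intro bexI[of _ "- x"]) (auto simp: complex_alg_def)
  qed (auto simp: complex_alg_def)
  show "monoid complex_alg" by (rule monoidI) (auto simp: complex_alg_def)
qed (auto simp: complex_alg_def algebra_simps)

lemma ring_sub_mat_alg:
  assumes "unital_cstar_subalgebra N A"
  shows "ring (sub_mat_alg N A)"
proof -
  have sub: "x \<in> carrier_mat N N" if "x \<in> A" for x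
    using assms that by (auto simp: unital_cstar_subalgebra_def)
  have add: "x + y \<in> A" and mult: "x * y \<in> A" if "x \<in> A" "y \<in> A" for x y
    using assms that by (auto simp: unital_cstar_subalgebra_def)
  have smult: "c \<cdot>\<^sub>m x \<in> A" if "x \<in> A" for x c
    using assms that by (auto simp: unital_cstar_subalgebra_def)
  have one: "1\<^sub>m N \<in> A" using assms by (auto simp: unital_cstar_subalgebra_def)
  have "0 \<cdot>\<^sub>m 1\<^sub>m N = (0\<^sub>m N N :: complex mat)" by (auto intro!: eq_matI)
  then have zero: "0\<^sub>m N N \<in> A" using smult[OF one, of 0] by simp
  show ?thesis
  proof (rule ringI)
    show "abelian_group (sub_mat_alg N A)"
    proof (rule abelian_groupI)
      fix x assume "x \<in> carrier (sub_mat_alg N A)"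
      then have x: "x \<in> A" by (simp add: sub_mat_alg_def)
      have "(- 1) \<cdot>\<^sub>m x + x = 0\<^sub>m N N" using sub[OF x] by (auto intro!: eq_matI)
      then show "\<exists>y\<in>carrier (sub_mat_alg N A). y \<oplus>\<^bsub>sub_mat_alg N A\<^esub> x = \<zero>\<^bsub>sub_mat_alg N A\<^esub>"
        using smult[OF x, of "- 1"] by (auto simp: sub_mat_alg_def)
    qed (auto simp: sub_mat_alg_def add zero sub
        intro: assoc_add_mat[of _ N N] comm_add_mat[of _ N N] left_add_zero_mat[of _ N N])
    show "monoid (sub_mat_alg N A)"
      by (rule monoidI) (auto simp: sub_mat_alg_def mult one sub
          intro: assoc_mult_mat[of _ N N _ N _ N] left_mult_one_mat[of _ N N]
              right_mult_one_mat[of _ N N])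
  qed (auto simp: sub_mat_alg_def sub intro: add_mult_distrib_mat[of _ N N _ _ N]
      mult_add_distrib_mat[of _ N N _ N])
qed

lemma norm_closed_carrier: "norm_closed N (carrier_mat N N)"
  by (auto simp: norm_closed_def)

lemma ring_mat_alg: "ring (mat_alg N)"
  unfolding mat_alg_def
  by (rule ring_sub_mat_alg) (auto simp: unital_cstar_subalgebra_def norm_closed_carrier)

text \<open>
  The first isomorphism theorem for rings provides the isomorphism; it respects scalars and adjoints
  because a *-homomorphism is constant on the cosets of its kernel, which makes the unions in the
  definition of the quotient algebra harmless.
\<close>

lemma quotient_by_kernel:
  fixes A :: "'a star_alg" and B :: "'b star_alg"
  assumes A: "ring A" and B: "ring B" and h: "star_hom A B h"
    and surj: "h ` carrier A = carrier B"
    and closed: "\<And>c x. x \<in> carrier A \<Longrightarrow> c \<odot>\<^bsub>A\<^esub> x \<in> carrier A"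
      "\<And>x. x \<in> carrier A \<Longrightarrow> adj A x \<in> carrier A"
    and K: "K = {x \<in> carrier A. h x = \<zero>\<^bsub>B\<^esub>}"
  shows "star_isomorphic (quot_alg A K) B"
proof -
  interpret ring_hom_ring A B h
    by (rule ring_hom_ringI2[OF A B star_hom_ring_hom[OF h]])
  have K': "K = a_kernel A B h" unfolding K a_kernel_def' by (rule refl)
  let ?\<phi> = "\<lambda>X. the_elem (h ` X)"
  have iso: "?\<phi> \<in> ring_iso (quot_alg A K) B"
    using FactRing_iso_set[OF surj] unfolding K'[symmetric]
    by (auto simp: ring_iso_def ring_hom_def quot_alg_def)
  have coset: "h ` (K +>\<^bsub>A\<^esub> a) = {h a}" if "a \<in> carrier A" for a
  proof -
    have "\<zero>\<^bsub>A\<^esub> \<in> K" using hom_zero by (auto simp: K)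
    then show ?thesis using that by (auto simp: a_r_coset_def' K image_iff)
  qed
  show ?thesis
    unfolding star_isomorphic_def
  proof (intro bexI[OF _ iso] ballI conjI allI)
    fix X c assume "X \<in> carrier (quot_alg A K)"
    then obtain a where a: "a \<in> carrier A" and X: "X = K +>\<^bsub>A\<^esub> a"
      by (auto simp: quot_alg_def FactRing_def A_RCOSETS_def')
    have hX: "h ` X = {h a}" unfolding X by (rule coset[OF a])
    have sub: "x \<in> carrier A" if "x \<in> X" for x
      using that a unfolding X by (auto simp: a_r_coset_def' K)
    have ne: "X \<noteq> {}" using hX by auto
    have hx: "h x = h a" if "x \<in> X" for x using hX that by auto
    have "h ` (\<Union>x\<in>X. K +>\<^bsub>A\<^esub> (c \<odot>\<^bsub>A\<^esub> x)) = (\<Union>x\<in>X. {h (c \<odot>\<^bsub>A\<^esub> x)})"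
      unfolding image_UN by (intro SUP_cong refl coset closed sub)
    also have "\<dots> = {c \<odot>\<^bsub>B\<^esub> h a}" using ne h sub hx by (auto simp: star_hom_def)
    finally show "?\<phi> (c \<odot>\<^bsub>quot_alg A K\<^esub> X) = c \<odot>\<^bsub>B\<^esub> ?\<phi> X" by (simp add: hX quot_alg_def)
    have "h ` (\<Union>x\<in>X. K +>\<^bsub>A\<^esub> (adj A x)) = (\<Union>x\<in>X. {h (adj A x)})"
      unfolding image_UN by (intro SUP_cong refl coset closed sub)
    also have "\<dots> = {adj B (h a)}" using ne h sub hx by (auto simp: star_hom_def)
    finally show "?\<phi> (adj (quot_alg A K) X) = adj B (?\<phi> X)" by (simp add: hX quot_alg_def)
  qed
qed

lemma mat_alg_1_iso: "star_isomorphic (mat_alg 1) complex_alg"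
  unfolding star_isomorphic_iff
proof (intro exI conjI)
  let ?\<phi> = "\<lambda>x :: complex mat. x $$ (0, 0)"
  show "star_hom (mat_alg 1) complex_alg ?\<phi>"
    unfolding star_hom_def ring_hom_def
    by (auto simp: mat_alg_def sub_mat_alg_def complex_alg_def scalar_prod_def
        mat_adjoint_index[of _ 1 1])
  show "bij_betw ?\<phi> (carrier (mat_alg 1)) (carrier complex_alg)"
  proof (rule bij_betw_byWitness[where f' = "\<lambda>c. mat 1 1 (\<lambda>_. c)"])
  qed (auto simp: mat_alg_def sub_mat_alg_def complex_alg_def intro!: eq_matI)
qed

lemma star_isomorphic_refl: "star_isomorphic A A"
  unfolding star_isomorphic_iff by (intro exI[of _ "\<lambda>x. x"])
      (auto simp: star_hom_def ring_hom_def bij_betw_def)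

context block_sum begin

abbreviation alg where "alg \<equiv> sub_mat_alg N (emb ` fam)"

lemma ring_alg: "ring alg"
  by (rule ring_sub_mat_alg) (rule unital_cstar_subalgebra_emb)

lemma block_ideal_ideal: "ideal (block_ideal F) alg"
proof (rule idealI[OF ring_alg])
  interpret ring alg by (rule ring_alg)
  have one: "1\<^sub>m N \<in> emb ` fam" "0\<^sub>m N N \<in> emb ` fam" unfolding emb_one emb_zero by auto
  show "subgroup (block_ideal F) (add_monoid alg)"
  proof (rule add.subgroupI)
    show "block_ideal F \<subseteq> carrier alg" by (auto simp: block_ideal_def sub_mat_alg_def)
    have "0\<^sub>m N N \<in> block_ideal F" unfolding emb_zero block_ideal_def by auto
    then show "block_ideal F \<noteq> {}" by auto
    fix a b assume "a \<in> block_ideal F"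
    then obtain x where x: "x \<in> fam" "a = emb x" "\<forall>k\<in>F. x k = 0\<^sub>m (m k) (m k)"
      by (auto simp: block_ideal_def)
    have "\<ominus>\<^bsub>alg\<^esub> a = (- 1) \<cdot>\<^sub>m a"
    proof (rule minus_equality)
      show "(- 1) \<cdot>\<^sub>m a \<oplus>\<^bsub>alg\<^esub> a = \<zero>\<^bsub>alg\<^esub>"
        using x by (auto simp: sub_mat_alg_def intro!: eq_matI)
    qed (use x in \<open>auto simp: sub_mat_alg_def emb_smult\<close>)
    also have "\<dots> \<in> block_ideal F"
      unfolding block_ideal_def x(2) emb_smult[OF x(1)] using x by (intro imageI) auto
    finally show "\<ominus>\<^bsub>alg\<^esub> a \<in> block_ideal F" .
    assume "b \<in> block_ideal F"
    then obtain y where y: "y \<in> fam" "b = emb y" "\<forall>k\<in>F. y k = 0\<^sub>m (m k) (m k)"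
      by (auto simp: block_ideal_def)
    show "a \<oplus>\<^bsub>alg\<^esub> b \<in> block_ideal F"
      using x y by (auto simp: sub_mat_alg_def emb_add block_ideal_def)
  qed
  fix a x assume "a \<in> block_ideal F" "x \<in> carrier alg"
  then obtain y z where y: "y \<in> fam" "a = emb y" "\<forall>k\<in>F. y k = 0\<^sub>m (m k) (m k)"
    and z: "z \<in> fam" "x = emb z" by (auto simp: block_ideal_def sub_mat_alg_def)
  show "x \<otimes>\<^bsub>alg\<^esub> a \<in> block_ideal F" "a \<otimes>\<^bsub>alg\<^esub> x \<in> block_ideal F"
    using y z left_mult_zero_mat[OF famD[OF z(1)]] right_mult_zero_mat[OF famD[OF z(1)]]
    by (auto simp: sub_mat_alg_def emb_mult block_ideal_def intro!: imageI)
qed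

lemma single_same [simp]: "single f z f = z"
  by (simp add: single_def)

lemma star_hom_block_at:
  assumes "k \<in> set ks"
  shows "star_hom alg (mat_alg (m k)) (block_at k)"
  using assms unfolding star_hom_def ring_hom_def
  by (auto simp: mat_alg_def sub_mat_alg_def emb_add emb_mult emb_smult emb_adjoint emb_one)

lemma alg_closed:
  "x \<in> carrier alg \<Longrightarrow> c \<odot>\<^bsub>alg\<^esub> x \<in> carrier alg" "x \<in> carrier alg \<Longrightarrow> adj alg x \<in> carrier alg"
  by (auto simp: sub_mat_alg_def emb_smult emb_adjoint)

lemma iso_zero_iff:
  assumes "ring A" "ring B" "star_hom A B \<phi>" "bij_betw \<phi> (carrier A) (carrier B)" "x \<in> carrier A"
  shows "\<phi> x = \<zero>\<^bsub>B\<^esub> \<longleftrightarrow> x = \<zero>\<^bsub>A\<^esub>"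
proof -
  interpret ring_hom_ring A B \<phi>
    by (rule ring_hom_ringI2[OF assms(1,2) star_hom_ring_hom[OF assms(3)]])
  show ?thesis using assms hom_zero bij_betw_imp_inj_on[OF assms(4)] R.zero_closed
    by (metis inj_onD)
qed

lemma quotient_block_ideal_one:
  assumes f: "f \<in> set ks" and B: "ring B" and iso: "star_isomorphic (mat_alg (m f)) B"
  shows "star_isomorphic (quot_alg alg (block_ideal {f})) B"
proof -
  obtain \<phi> where \<phi>: "star_hom (mat_alg (m f)) B \<phi>"
    and bij: "bij_betw \<phi> (carrier (mat_alg (m f))) (carrier B)"
    using iso by (auto simp: star_isomorphic_iff)
  have c: "block_at f x \<in> carrier (mat_alg (m f))" for x
    by (simp add: mat_alg_def sub_mat_alg_def)
  show ?thesis
  proof (rule quotient_by_kernel[OF ring_alg B star_hom_compose[OF star_hom_block_at[OF f] \<phi>] _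
      alg_closed])
    show "(\<lambda>x. \<phi> (block_at f x)) ` carrier alg = carrier B"
    proof
      show "(\<lambda>x. \<phi> (block_at f x)) ` carrier alg \<subseteq> carrier B" using bij c
        by (auto simp: bij_betw_def)
      show "carrier B \<subseteq> (\<lambda>x. \<phi> (block_at f x)) ` carrier alg"
      proof
        fix b assume "b \<in> carrier B"
        then obtain z where z: "z \<in> carrier_mat (m f) (m f)" "b = \<phi> z"
          using bij by (auto simp: bij_betw_def mat_alg_def sub_mat_alg_def)
        then show "b \<in> (\<lambda>x. \<phi> (block_at f x)) ` carrier alg"
          using f by (intro image_eqI[of _ _ "emb (single f z)"]) (auto simp: sub_mat_alg_def)
      qed
    qed
    show "block_ideal {f} = {x \<in> carrier alg. \<phi> (block_at f x) = \<zero>\<^bsub>B\<^esub>}"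
      unfolding iso_zero_iff[OF ring_mat_alg B \<phi> bij c] using f
      by (auto simp: mat_alg_def sub_mat_alg_def block_ideal_def)
  qed
qed

lemma quotient_block_ideal_two:
  assumes f: "f \<in> set ks" and B: "ring B" and iso: "star_isomorphic (mat_alg (m f)) B"
    and g: "g \<in> set ks" and C: "ring C" and iso': "star_isomorphic (mat_alg (m g)) C"
    and ne: "f \<noteq> g"
  shows "star_isomorphic (quot_alg alg (block_ideal {f, g})) (dsum_alg B C)"
proof -
  obtain \<phi> where \<phi>: "star_hom (mat_alg (m f)) B \<phi>"
    and bij: "bij_betw \<phi> (carrier (mat_alg (m f))) (carrier B)"
    using iso by (auto simp: star_isomorphic_iff)
  obtain \<psi> where \<psi>: "star_hom (mat_alg (m g)) C \<psi>"
    and bij': "bij_betw \<psi> (carrier (mat_alg (m g))) (carrier C)"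
    using iso' by (auto simp: star_isomorphic_iff)
  have c: "block_at k x \<in> carrier (mat_alg (m k))" for x k
    by (simp add: mat_alg_def sub_mat_alg_def)
  let ?h = "\<lambda>x. (\<phi> (block_at f x), \<psi> (block_at g x))"
  have dc: "carrier (dsum_alg B C) = carrier B \<times> carrier C" "\<zero>\<^bsub>dsum_alg B C\<^esub> = (\<zero>\<^bsub>B\<^esub>, \<zero>\<^bsub>C\<^esub>)"
    by (auto simp: dsum_alg_def)
  show ?thesis
  proof (rule quotient_by_kernel[OF ring_alg ring_dsum_alg[OF B C] star_hom_Pair[OF
          star_hom_compose[OF star_hom_block_at[OF f] \<phi>]
              star_hom_compose[OF star_hom_block_at[OF g] \<psi>]]
          _ alg_closed])
    show "?h ` carrier alg = carrier (dsum_alg B C)"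
    proof
      show "?h ` carrier alg \<subseteq> carrier (dsum_alg B C)"
        using bij bij' c unfolding dc by (auto simp: bij_betw_def)
      show "carrier (dsum_alg B C) \<subseteq> ?h ` carrier alg"
      proof
        fix b assume "b \<in> carrier (dsum_alg B C)"
        then have b: "fst b \<in> carrier B" "snd b \<in> carrier C" by (auto simp: dc)
        obtain z where z: "z \<in> carrier_mat (m f) (m f)" "fst b = \<phi> z"
          using b bij by (auto simp: bij_betw_def mat_alg_def sub_mat_alg_def)
        obtain w where w: "w \<in> carrier_mat (m g) (m g)" "snd b = \<psi> w"
          using b bij' by (auto simp: bij_betw_def mat_alg_def sub_mat_alg_def)
        let ?x = "(single f z)(g := w)"
        have x: "?x \<in> fam" using z w by (auto simp: fam_def single_def simp del: famD)
        have "b = ?h (emb ?x)"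
          using z w f g ne x by (simp add: prod_eq_iff)
        then show "b \<in> ?h ` carrier alg"
          using x by (intro image_eqI[of _ _ "emb ?x"]) (auto simp: sub_mat_alg_def)
      qed
    qed
    show "block_ideal {f, g} = {x \<in> carrier alg. ?h x = \<zero>\<^bsub>dsum_alg B C\<^esub>}"
      unfolding dc prod.inject iso_zero_iff[OF ring_mat_alg B \<phi> bij c]
          iso_zero_iff[OF ring_mat_alg C \<psi> bij' c]
      using f g by (auto simp: mat_alg_def sub_mat_alg_def block_ideal_def)
  qed
qed

end

section \<open>Boundary ideals and the Shilov ideal\<close>

lemma block_fnorm_1: "block_fnorm (Suc 0) n u = fnorm n (u 0)"
  by (simp add: block_fnorm_def L2_set_def lessThan_Suc)

lemma block_sesq_1: "block_sesq (Suc 0) n X u v = sesq n (X 0 0) (u 0) (v 0)"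
  by (simp add: block_sesq_def lessThan_Suc)

lemma block_fnorm_isometry:
  assumes "\<And>u v. fip n (U u) (U v) = fip k u v"
  shows "block_fnorm p n (\<lambda>i. U (u i)) = block_fnorm p k u"
proof -
  have "fnorm n (U w) = fnorm k w" for w
  proof (rule power2_eq_imp_eq)
    show "(fnorm n (U w))\<^sup>2 = (fnorm k w)\<^sup>2"
      using assms[of w w] unfolding fip_self by (simp only: of_real_eq_iff)
  qed auto
  then show ?thesis by (simp add: block_fnorm_def)
qed

lemma sesq_affine:
  assumes "J \<in> carrier_mat n n"
  shows "sesq n (a \<cdot>\<^sub>m 1\<^sub>m n + b \<cdot>\<^sub>m J + c \<cdot>\<^sub>m mat_adjoint J) u v =
    a * fip n u v + b * sesq n J u v + c * cnj (sesq n J v u)"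
proof -
  have 1: "(\<Sum>e<n. cnj (u d) * (if d = e then 1 else 0) * v e) = cnj (u d) * v d" if "d < n" for d
  proof -
    have "(\<Sum>e<n. cnj (u d) * (if d = e then 1 else 0) * v e)
        = (\<Sum>e<n. if d = e then cnj (u d) * v d else 0)"
      by (intro sum.cong refl) auto
    then show ?thesis using that by simp
  qed
  have "sesq n (a \<cdot>\<^sub>m 1\<^sub>m n + b \<cdot>\<^sub>m J + c \<cdot>\<^sub>m mat_adjoint J) u v =
    (\<Sum>d<n. \<Sum>e<n. a * (cnj (u d) * (if d = e then 1 else 0) * v e)
       + b * (cnj (u d) * J $$ (d, e) * v e) + c * (cnj (u d) * cnj (J $$ (e, d)) * v e))"
    unfolding sesq_def
    by (rule sum.cong[OF refl], rule sum.cong[OF refl])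
      (use assms in \<open>auto simp: mat_adjoint_index[OF assms] algebra_simps
          carrier_matD[OF mat_adjoint_carrier[OF assms]]\<close>)
  also have "\<dots> = a * (\<Sum>d<n. \<Sum>e<n. cnj (u d) * (if d = e then 1 else 0) * v e)
       + b * sesq n J u v + c * (\<Sum>d<n. \<Sum>e<n. cnj (u d) * cnj (J $$ (e, d)) * v e)"
    unfolding sesq_def by (simp only: sum.distrib sum_distrib_left)
  also have "(\<Sum>d<n. \<Sum>e<n. cnj (u d) * (if d = e then 1 else 0) * v e) = fip n u v"
    unfolding fip_def by (intro sum.cong[OF refl]) (simp add: 1 del: mult_cancel_left)
  also have "(\<Sum>d<n. \<Sum>e<n. cnj (u d) * cnj (J $$ (e, d)) * v e) = cnj (sesq n J v u)"
    unfolding sesq_def by (subst sum.swap) (simp add: mult_ac)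
  finally show ?thesis .
qed

text \<open>
  In matrix terms: \<open>J = t U* A U + (1 - t) V* B V\<close> with isometries \<open>U\<close> and \<open>V\<close>.
\<close>

definition convex_dilation ::
  "nat \<Rightarrow> complex mat \<Rightarrow> real \<Rightarrow> nat \<Rightarrow> complex mat \<Rightarrow> nat \<Rightarrow> complex mat \<Rightarrow> bool" where
  "convex_dilation k J t n A n' B \<longleftrightarrow> 0 \<le> t \<and> t \<le> 1 \<and>
     (\<exists>U V. (\<forall>u v. fip n (U u) (U v) = fip k u v) \<and> (\<forall>u v. fip n' (V u) (V v) = fip k u v) \<and>
       (\<forall>u v. sesq k J u v = complex_of_real t * sesq n A (U u) (U v) +
          complex_of_real (1 - t) * sesq n' B (V u) (V v)))"

context jordan_blocks
begin

lemma sesq_os_block: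
  "sesq (m k) (os_block a b c k) u v =
     a * fip (m k) u v + b * sesq (m k) (jblock k) u v + c * cnj (sesq (m k) (jblock k) v u)"
  unfolding os_block_def by (rule sesq_affine) simp

text \<open>
  The convex combination that represents \<open>J\<^sub>k\<close> also represents \<open>1\<close> and \<open>J\<^sub>k*\<close>, hence the \<open>k\<close>-th block of
  every element of the operator system, and it commutes with taking matrices of such elements.  The
  bound then passes from the blocks \<open>f\<close> and \<open>g\<close> to \<open>k\<close> by convexity.
\<close>

lemma block_sesq_os_block_le:
  assumes x: "\<And>i j. i < p \<Longrightarrow> j < p \<Longrightarrow> x i j = os_block (a i j) (b i j) (c i j)"
    and dil: "convex_dilation (m k) (jblock k) t (m f) (jblock f) (m g) (jblock g)"
    and C: "\<And>u v. cmod (block_sesq p (m f) (\<lambda>i j. x i j f) u v)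
        \<le> C * block_fnorm p (m f) u * block_fnorm p (m f) v"
      "\<And>u v. cmod (block_sesq p (m g) (\<lambda>i j. x i j g) u v)
          \<le> C * block_fnorm p (m g) u * block_fnorm p (m g) v"
  shows "cmod (block_sesq p (m k) (\<lambda>i j. x i j k) u v)
      \<le> C * block_fnorm p (m k) u * block_fnorm p (m k) v"
proof -
  from dil obtain U V where t: "0 \<le> t" "t \<le> 1"
    and U: "\<And>u v. fip (m f) (U u) (U v) = fip (m k) u v"
    and V: "\<And>u v. fip (m g) (V u) (V v) = fip (m k) u v"
    and J: "\<And>u v. sesq (m k) (jblock k) u v =
        complex_of_real t * sesq (m f) (jblock f) (U u) (U v) +
          complex_of_real (1 - t) * sesq (m g) (jblock g) (V u) (V v)"
    unfolding convex_dilation_def by blast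
  have one: "fip (m k) u v = complex_of_real t * fip (m f) (U u) (U v) +
      complex_of_real (1 - t) * fip (m g) (V u) (V v)" for u v
    by (simp add: U V algebra_simps)
  have "sesq (m k) (x i j k) u v = t * sesq (m f) (x i j f) (U u) (U v)
      + (1 - t) * sesq (m g) (x i j g) (V u) (V v)" if "i < p" "j < p" for i j u v
    unfolding x[OF that] sesq_os_block J one by (simp add: algebra_simps)
  then have split: "block_sesq p (m k) (\<lambda>i j. x i j k) u v =
      complex_of_real t * block_sesq p (m f) (\<lambda>i j. x i j f) (\<lambda>i. U (u i)) (\<lambda>i. U (v i)) +
      complex_of_real (1 - t) * block_sesq p (m g) (\<lambda>i j. x i j g) (\<lambda>i. V (u i)) (\<lambda>i. V (v i))"
    unfolding block_sesq_def by (simp add: sum.distrib sum_distrib_left)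
  have "cmod (block_sesq p (m k) (\<lambda>i j. x i j k) u v)
      \<le> t * cmod (block_sesq p (m f) (\<lambda>i j. x i j f) (\<lambda>i. U (u i)) (\<lambda>i. U (v i))) +
      (1 - t) * cmod (block_sesq p (m g) (\<lambda>i j. x i j g) (\<lambda>i. V (u i)) (\<lambda>i. V (v i)))"
  proof -
    have "cmod (complex_of_real (1 - t)) = 1 - t" using t by (subst norm_of_real) simp
    moreover have "cmod (complex_of_real t) = t" using t by (subst norm_of_real) simp
    ultimately show ?thesis
      unfolding split by (intro order_trans[OF norm_triangle_ineq])
          (simp only: norm_mult order_refl)
  qed
  also have "\<dots> \<le> t * (C * block_fnorm p (m k) u * block_fnorm p (m k) v)
      + (1 - t) * (C * block_fnorm p (m k) u * block_fnorm p (m k) v)"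
    using C(1)[of "\<lambda>i. U (u i)" "\<lambda>i. U (v i)"] C(2)[of "\<lambda>i. V (u i)" "\<lambda>i. V (v i)"] t
    unfolding block_fnorm_isometry[of "m f" U "m k", OF U]
      block_fnorm_isometry[of "m g" V "m k", OF V]
    by (intro add_mono mult_left_mono) auto
  also have "\<dots> = C * block_fnorm p (m k) u * block_fnorm p (m k) v" by (simp add: algebra_simps)
  finally show ?thesis .
qed

text \<open>
  Changing the representatives of the cosets leaves the blocks in \<open>F\<close> alone, and those already
  determine the norm of a matrix over the operator system.
\<close>

lemma boundary_idealI:
  assumes F: "F \<subseteq> set ks"
    and dil: "\<And>k. k \<in> set ks \<Longrightarrow>
      \<exists>t. \<exists>f\<in>F. \<exists>g\<in>F. convex_dilation (m k) (jblock k) t (m f) (jblock f) (m g) (jblock g)"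
  shows "boundary_ideal T (block_ideal F)"
  unfolding boundary_ideal_def cstar_gen_eq dim_T
proof (intro conjI allI impI)
  show "ideal (block_ideal F) alg" by (rule block_ideal_ideal)
  show "norm_closed N (block_ideal F)" by (rule norm_closed_block_ideal)
  fix p :: nat and X assume p: "p > 0" and X: "\<forall>i<p. \<forall>j<p. X i j \<in> op_system T"
  have "\<exists>a b c. X i j = emb (os_block a b c)" if "i < p" "j < p" for i j
    using X that unfolding op_system_eq by blast
  then obtain a b c
    where abc: "\<And>i j. i < p \<Longrightarrow> j < p \<Longrightarrow> X i j = emb (os_block (a i j) (b i j) (c i j))"
    by metis
  define x where "x i j = os_block (a i j) (b i j) (c i j)" for i j
  have Xx: "X i j = emb (x i j) \<and> x i j \<in> fam" if "i < p" "j < p" for i j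
    using abc that by (simp add: x_def)
  have coset: "\<exists>y \<in> fam. Y = emb y \<and> (\<forall>f\<in>F. y f = x i j f)"
    if "Y \<in> block_ideal F +>\<^bsub>alg\<^esub> X i j" "i < p" "j < p" for Y i j
  proof -
    from that obtain z where z: "z \<in> fam" "\<forall>k\<in>F. z k = 0\<^sub>m (m k) (m k)" "Y = emb z + X i j"
      by (auto simp: a_r_coset_def' block_ideal_def sub_mat_alg_def)
    have xf: "x i j \<in> fam" using Xx that by simp
    show ?thesis
      using z xf Xx[OF that(2,3)] left_add_zero_mat[OF famD[OF xf]]
      by (intro bexI[of _ "\<lambda>k. z k + x i j k"]) (auto simp: emb_add)
  qed
  have self: "X i j \<in> block_ideal F +>\<^bsub>alg\<^esub> X i j" if "i < p" "j < p" for i j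
  proof -
    have "0\<^sub>m N N \<in> block_ideal F" unfolding emb_zero block_ideal_def by auto
    moreover have "X i j = 0\<^sub>m N N + X i j"
      using Xx[OF that] left_add_zero_mat[OF emb_carrier] by simp
    ultimately show ?thesis by (auto simp: a_r_coset_def' sub_mat_alg_def)
  qed
  show "quot_mat_norm p N (\<lambda>i j. block_ideal F +>\<^bsub>alg\<^esub> X i j) = op_norm (block_mat p N X)"
    unfolding quot_mat_norm_def
  proof (rule cInf_eq_minimum)
    show "op_norm (block_mat p N X) \<in> {op_norm (block_mat p N Y) | Y.
        \<forall>i<p. \<forall>j<p. Y i j \<in> block_ideal F +>\<^bsub>alg\<^esub> X i j}"
      using self by blast
    fix r assume "r \<in> {op_norm (block_mat p N Y) | Y.
        \<forall>i<p. \<forall>j<p. Y i j \<in> block_ideal F +>\<^bsub>alg\<^esub> X i j}"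
    then obtain Y where r: "r = op_norm (block_mat p N Y)"
      and Y: "\<And>i j. i < p \<Longrightarrow> j < p \<Longrightarrow> Y i j \<in> block_ideal F +>\<^bsub>alg\<^esub> X i j" by auto
    have "\<forall>i j. \<exists>y. i < p \<longrightarrow> j < p \<longrightarrow> (Y i j = emb y \<and> y \<in> fam) \<and> (\<forall>f\<in>F. y f = x i j f)"
      using coset Y by blast
    then obtain y where y: "\<And>i j. i < p \<Longrightarrow> j < p \<Longrightarrow> Y i j = emb (y i j) \<and> y i j \<in> fam"
      and yx: "\<And>i j f. i < p \<Longrightarrow> j < p \<Longrightarrow> f \<in> F \<Longrightarrow> y i j f = x i j f" by metis
    have inF: "cmod (block_sesq p (m f) (\<lambda>i j. x i j f) u v)
        \<le> r * block_fnorm p (m f) u * block_fnorm p (m f) v"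
      if "f \<in> F" for f u v
    proof -
      have "block_sesq p (m f) (\<lambda>i j. x i j f) u v = block_sesq p (m f) (\<lambda>i j. y i j f) u v"
        unfolding block_sesq_def using yx that by (intro sum.cong[OF refl]) auto
      moreover have "cmod (block_sesq p (m f) (\<lambda>i j. y i j f) u v)
          \<le> r * block_fnorm p (m f) u * block_fnorm p (m f) v"
        unfolding r by (rule block_sesq_le_of_emb[OF y]) (use that F in auto)
      ultimately show ?thesis by simp
    qed
    show "op_norm (block_mat p N X) \<le> r"
    proof (rule op_norm_block_mat_leI)
      show r0: "0 \<le> r" unfolding r by (rule op_norm_nonneg[OF block_mat_carrier])
      fix u v
      show "cmod (block_sesq p N X u v) \<le> r * block_fnorm p N u * block_fnorm p N v"
      proof (rule block_sesq_emb_le[OF Xx r0])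
        fix k u v assume "k \<in> set ks"
        then obtain t f g where fg: "f \<in> F" "g \<in> F"
          and d: "convex_dilation (m k) (jblock k) t (m f) (jblock f) (m g) (jblock g)"
          using dil by blast
        show "cmod (block_sesq p (m k) (\<lambda>i j. x i j k) u v)
            \<le> r * block_fnorm p (m k) u * block_fnorm p (m k) v"
          by (rule block_sesq_os_block_le[OF _ d inF[OF fg(1)] inF[OF fg(2)]]) (rule x_def)
      qed
    qed
  qed
qed

text \<open>
  The restriction to block \<open>f\<close> is a peaking representation in the sense of Arveson, already at the first
  matrix level.
\<close>

definition peaking :: "nat \<Rightarrow> bool" where
  "peaking f \<longleftrightarrow> (\<exists>a b c C. 0 \<le> C \<and> C < op_norm (os_block a b c f) \<and>
     (\<forall>k\<in>set ks - {f}. op_norm (os_block a b c k) \<le> C))"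

text \<open>
  An element of \<open>K\<close> with nonzero block \<open>f\<close> generates the unit of block \<open>f\<close>, because matrix algebras are
  simple.  Modulo \<open>K\<close> the block \<open>f\<close> of an element at which \<open>f\<close> peaks can then be replaced by \<open>0\<close>, which
  makes its norm strictly smaller.
\<close>

lemma boundary_ideal_subset:
  assumes K: "boundary_ideal T K" and F: "F \<subseteq> set ks"
    and peak: "\<And>f. f \<in> F \<Longrightarrow> peaking f"
  shows "K \<subseteq> block_ideal F"
proof
  interpret K: ideal K alg using K by (simp add: boundary_ideal_def cstar_gen_eq)
  have alg: "emb y \<in> carrier alg" if "y \<in> fam" for y using that by (simp add: sub_mat_alg_def)
  have add: "emb (\<lambda>k. y k + z k) \<in> K" if "y \<in> fam" "z \<in> fam" "emb y \<in> K" "emb z \<in> K" for y z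
    using additive_subgroup.a_closed[OF K.additive_subgroup_axioms that(3,4)] that
    by (simp add: sub_mat_alg_def emb_add)
  have lmult: "emb (\<lambda>k. y k * z k) \<in> K" if "y \<in> fam" "z \<in> fam" "emb z \<in> K" for y z
    using K.I_l_closed[OF that(3) alg[OF that(1)]] that by (simp add: sub_mat_alg_def emb_mult)
  have rmult: "emb (\<lambda>k. z k * y k) \<in> K" if "y \<in> fam" "z \<in> fam" "emb z \<in> K" for y z
    using K.I_r_closed[OF that(3) alg[OF that(1)]] that by (simp add: sub_mat_alg_def emb_mult)
  have zero: "emb (\<lambda>k. 0\<^sub>m (m k) (m k)) \<in> K"
    using additive_subgroup.zero_closed[OF K.additive_subgroup_axioms]
    by (simp add: sub_mat_alg_def emb_zero[symmetric])
  fix x assume xK: "x \<in> K"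
  then have "x \<in> carrier alg" using K.a_subset by blast
  then obtain y where y: "y \<in> fam" "x = emb y" by (auto simp: sub_mat_alg_def)
  have "y f = 0\<^sub>m (m f) (m f)" if f: "f \<in> F" for f
  proof (rule ccontr)
    assume ne: "y f \<noteq> 0\<^sub>m (m f) (m f)"
    have fks: "f \<in> set ks" using f F by auto
    obtain i j where ij: "i < m f" "j < m f" "y f $$ (i, j) \<noteq> 0"
      using ne eq_matI[of "0\<^sub>m (m f) (m f)" "y f"] y(1) by auto
    let ?d = "y f $$ (i, j)"
    let ?D = "\<lambda>r. mat (m f) (m f) (\<lambda>(a, b). if a = b \<and> a < r then 1 else 0) :: complex mat"
    \<comment> \<open>Multiplying by matrix units on both sides moves the nonzero entry to any diagonal position.\<close>
    have "emb (single f (mat_unit (m f) a a)) \<in> K" if a: "a < m f" for a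
    proof -
      have "emb (\<lambda>k. single f ((1 / ?d) \<cdot>\<^sub>m mat_unit (m f) a i) k *
          (y k * single f (mat_unit (m f) j a) k)) \<in> K"
        using y xK by (intro lmult rmult single_fam fam_mult smult_carrier_mat
            mat_unit_carrier) auto
      moreover have "single f ((1 / ?d) \<cdot>\<^sub>m mat_unit (m f) a i) k *
          (y k * single f (mat_unit (m f) j a) k)
          = single f (mat_unit (m f) a a) k" for k
      proof (cases "k = f")
        case True
        have "mat_unit (m f) a i * (y f * mat_unit (m f) j a) = ?d \<cdot>\<^sub>m mat_unit (m f) a a"
          unfolding mult_mat_unit[OF famD[OF y(1)] ij(2)]
          by (subst mat_unit_mult) (use ij in \<open>auto simp: mat_unit_def intro!: eq_matI\<close>)
        moreover have "((1 / ?d) \<cdot>\<^sub>m mat_unit (m f) a i) * (y f * mat_unit (m f) j a) =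
           (1 / ?d) \<cdot>\<^sub>m (mat_unit (m f) a i * (y f * mat_unit (m f) j a))"
          using y(1) by (intro mult_smult_assoc_mat[of _ "m f" "m f" _ "m f"] mult_carrier_mat)
              auto
        ultimately show ?thesis using True ij by (auto simp: single_def intro!: eq_matI)
      next
        case False
        then show ?thesis
          using y(1) by (simp add: single_def)
      qed
      ultimately show ?thesis by simp
    qed
    note diag = this
    have "emb (single f (?D r)) \<in> K" if "r \<le> m f" for r
      using that
    proof (induction r)
      case 0
      have D0: "single f (?D 0) = (\<lambda>k. 0\<^sub>m (m k) (m k))"
        by (intro ext eq_matI) (auto simp: single_def)
      show ?case unfolding D0 by (rule zero)
    next
      case (Suc r)
      have "(\<lambda>k. single f (?D r) k + single f (mat_unit (m f) r r) k) = single f (?D (Suc r))"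
        by (intro ext) (auto simp: single_def mat_unit_def intro!: eq_matI)
      then show ?case using add[of "single f (?D r)" "single f (mat_unit (m f) r r)"] Suc
          diag[of r] by simp
    qed
    from this[of "m f"] have "emb (single f (?D (m f))) \<in> K" by simp
    moreover have "?D (m f) = 1\<^sub>m (m f)" by (auto intro!: eq_matI)
    ultimately have e: "emb (single f (1\<^sub>m (m f))) \<in> K" by simp
    obtain a b c C where C: "0 \<le> C" and gt: "C < op_norm (os_block a b c f)"
      and le: "\<And>k. k \<in> set ks \<Longrightarrow> k \<noteq> f \<Longrightarrow> op_norm (os_block a b c k) \<le> C"
      using peak[OF f] unfolding peaking_def by blast
    let ?s = "os_block a b c"
    let ?X = "\<lambda>(_::nat) (_::nat). emb ?s"
    \<comment> \<open>Another representative of the coset of \<open>emb ?s\<close>, with block \<open>f\<close> removed.\<close>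
    define z where "z k = single f ((- 1) \<cdot>\<^sub>m ?s f) k + ?s k" for k
    have zf: "z \<in> fam" unfolding z_def
      by (intro fam_add single_fam smult_carrier_mat famD os_block_fam)
    have "emb (\<lambda>k. single f (1\<^sub>m (m f)) k * single f ((- 1) \<cdot>\<^sub>m ?s f) k) \<in> K"
      by (rule rmult[OF single_fam single_fam e]) auto
    moreover have "(\<lambda>k. single f (1\<^sub>m (m f)) k * single f ((- 1) \<cdot>\<^sub>m ?s f) k)
        = single f ((- 1) \<cdot>\<^sub>m ?s f)"
      using left_mult_one_mat[of "(- 1) \<cdot>\<^sub>m ?s f" "m f" "m f"]
      by (intro ext) (auto simp: single_def)
    ultimately have "emb (single f ((- 1) \<cdot>\<^sub>m ?s f)) \<in> K" by simp
    moreover have "emb z = emb (single f ((- 1) \<cdot>\<^sub>m ?s f)) + emb ?s"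
      unfolding z_def by (rule emb_add[symmetric]) (auto intro: single_fam)
    ultimately have zK: "emb z \<in> K +>\<^bsub>alg\<^esub> emb ?s"
      unfolding a_r_coset_def' by (auto simp: sub_mat_alg_def)
    have "quot_mat_norm 1 N (\<lambda>i j. K +>\<^bsub>alg\<^esub> ?X i j) \<le> op_norm (block_mat 1 N (\<lambda>_ _. emb z))"
      unfolding quot_mat_norm_def
    proof (rule cInf_lower)
      show "bdd_below {op_norm (block_mat 1 N Y) | Y. \<forall>i<1. \<forall>j<1. Y i j \<in> K +>\<^bsub>alg\<^esub> ?X i j}"
        by (rule bdd_belowI[of _ 0]) (auto intro: op_norm_nonneg[OF block_mat_carrier])
    qed (use zK in blast)
    also have "\<dots> \<le> C"
    proof (rule op_norm_block_mat_leI[OF C], rule block_sesq_emb_le[OF _ C])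
      show "emb z = emb z \<and> z \<in> fam" using zf by simp
      fix k and u w :: "nat \<Rightarrow> nat \<Rightarrow> complex" assume k: "k \<in> set ks"
      have "cmod (sesq (m k) (z k) (u 0) (w 0)) \<le> C * fnorm (m k) (u 0) * fnorm (m k) (w 0)"
      proof (cases "k = f")
        case True
        have "z k = 0\<^sub>m (m k) (m k)" unfolding z_def single_def True by (auto intro!: eq_matI)
        then show ?thesis using C by (simp add: sesq_def)
      next
        case False
        then have "z k = ?s k" unfolding z_def single_def by auto
        moreover have "op_norm (?s k) * fnorm (m k) (u 0) * fnorm (m k) (w 0)
            \<le> C * fnorm (m k) (u 0) * fnorm (m k) (w 0)"
          by (intro mult_right_mono le[OF k False]) auto
        ultimately show ?thesis
          using sesq_le_op_norm[OF famD[OF os_block_fam], of k a b c "u 0" "w 0"] by simp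
      qed
      then show "cmod (block_sesq 1 (m k) (\<lambda>i j. z k) u w)
          \<le> C * block_fnorm 1 (m k) u * block_fnorm 1 (m k) w"
        by (simp add: block_sesq_1 block_fnorm_1)
    qed
    also have "quot_mat_norm 1 N (\<lambda>i j. K +>\<^bsub>alg\<^esub> ?X i j) = op_norm (block_mat 1 N ?X)"
    proof -
      have "emb ?s \<in> op_system T" unfolding op_system_eq by blast
      then show ?thesis using K unfolding boundary_ideal_def cstar_gen_eq dim_T
        by (elim conjE allE[of _ "1 :: nat"]) auto
    qed
    finally have le_C: "op_norm (block_mat 1 N ?X) \<le> C" .
    have "op_norm (?s f) \<le> op_norm (block_mat 1 N ?X)"
    proof (rule op_norm_le_sesqI[OF famD[OF os_block_fam] op_norm_nonneg[OF block_mat_carrier]])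
      fix u v
      have "cmod (block_sesq 1 (m f) (\<lambda>i j. ?s f) (\<lambda>_. u) (\<lambda>_. v))
        \<le> op_norm (block_mat 1 N ?X) * block_fnorm 1 (m f) (\<lambda>_. u) * block_fnorm 1 (m f) (\<lambda>_. v)"
        by (rule block_sesq_le_of_emb[OF _ fks]) simp
      then show "cmod (sesq (m f) (?s f) u v)
          \<le> op_norm (block_mat 1 N ?X) * fnorm (m f) u * fnorm (m f) v"
        by (simp add: block_sesq_1 block_fnorm_1)
    qed
    then show False using gt le_C by simp
  qed
  then show "x \<in> block_ideal F" using y by (auto simp: block_ideal_def)
qed

theorem cstar_envelope_eq:
  assumes F: "F \<subseteq> set ks"
    and dil: "\<And>k. k \<in> set ks \<Longrightarrow>
      \<exists>t. \<exists>f\<in>F. \<exists>g\<in>F. convex_dilation (m k) (jblock k) t (m f) (jblock f) (m g) (jblock g)"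
    and peak: "\<And>f. f \<in> F \<Longrightarrow> peaking f"
  shows "cstar_envelope T = quot_alg alg (block_ideal F)"
proof -
  have "shilov_ideal T = block_ideal F"
    unfolding shilov_ideal_def
  proof (rule Greatest_equality)
    show "boundary_ideal T (block_ideal F)" by (rule boundary_idealI[OF F]) (rule dil)
    fix K assume "boundary_ideal T K"
    then show "K \<subseteq> block_ideal F" by (rule boundary_ideal_subset[OF _ F]) (rule peak)
  qed
  then show ?thesis by (simp add: cstar_envelope_def cstar_gen_eq)
qed

end

section \<open>Compressions of Jordan blocks\<close>

definition shift :: "nat \<Rightarrow> (nat \<Rightarrow> complex) \<Rightarrow> nat \<Rightarrow> complex" where
  "shift n v = (\<lambda>a. if Suc a < n then v (Suc a) else 0)"

lemma fmul_jordan_block: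
  assumes "a < n"
  shows "fmul n (jordan_block n c) v a = c * v a + shift n v a"
proof -
  have "fmul n (jordan_block n c) v a =
      (\<Sum>b<n. (if b = a then c * v a else 0) + (if b = Suc a then v (Suc a) else 0))"
    unfolding fmul_def using assms by (intro sum.cong refl) auto
  then show ?thesis using assms by (simp add: sum.distrib shift_def)
qed

lemma fip_cong: "(\<And>a. a < n \<Longrightarrow> u a = u' a) \<Longrightarrow> (\<And>a. a < n \<Longrightarrow> v a = v' a) \<Longrightarrow> fip n u v = fip n u' v'"
  by (simp add: fip_def)

lemma sesq_jordan_block: "sesq n (jordan_block n c) u v = c * fip n u v + fip n u (shift n v)"
proof -
  have "sesq n (jordan_block n c) u v = fip n u (\<lambda>a. c * v a + shift n v a)"
    unfolding sesq_eq_fip by (rule fip_cong) (auto simp: fmul_jordan_block)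
  then show ?thesis by (simp add: fip_def sum.distrib sum_distrib_left algebra_simps)
qed

lemma convex_dilation_refl: "convex_dilation k J 1 k J k J"
  unfolding convex_dilation_def by (auto intro!: exI[of _ "\<lambda>u. u"])

lemma sum_zero_extend:
  fixes f :: "nat \<Rightarrow> 'a :: comm_monoid_add"
  assumes "k \<le> n" "\<And>a. a < n \<Longrightarrow> k \<le> a \<Longrightarrow> f a = 0"
  shows "(\<Sum>a<n. f a) = (\<Sum>a<k. f a)"
  using assms by (intro sum.mono_neutral_right) auto

text \<open>
  The corner of size \<open>k\<close> of a larger Jordan block is the Jordan block of size \<open>k\<close> with the same
  eigenvalue, and the average of two Jordan blocks of size \<open>k\<close> averages the eigenvalues.
\<close>

lemma convex_dilation_compress:
  assumes "k \<le> n" "k \<le> n'" "0 \<le> t" "t \<le> 1" "c = t * a + (1 - t) * b"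
  shows "convex_dilation k (jordan_block k (complex_of_real c)) t
    n (jordan_block n (complex_of_real a)) n' (jordan_block n' (complex_of_real b))"
proof -
  define U where "U u = (\<lambda>i. if i < k then u i else 0 :: complex)" for u
  have ip: "fip n (U u) (U v) = fip k u v" if "k \<le> n" for u v n
    unfolding fip_def using that by (subst sum_zero_extend[of k]) (auto simp: U_def)
  have sh: "fip n (U u) (shift n (U v)) = fip k u (shift k v)" if "k \<le> n" for u v n
    unfolding fip_def using that by (subst sum_zero_extend[of k])
        (auto simp: U_def shift_def intro!: sum.cong)
  show ?thesis
    unfolding convex_dilation_def sesq_jordan_block assms(5)
    using assms(1-4) by (intro conjI exI[of _ U]) (auto simp: ip sh algebra_simps)
qed

text \<open>
  The recurrence says that \<open>sin (j \<theta>)\<close> is an eigenvector of the shift plus its adjoint, provided that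
  the boundary terms vanish; they do for \<open>\<theta> = \<pi> / (n + 1)\<close>.
\<close>

lemma sin_recurrence:
  "sin (real a * \<theta>) + sin (real (Suc (Suc a)) * \<theta>) = 2 * cos \<theta> * sin (real (Suc a) * \<theta>)"
proof -
  have 1: "real a * \<theta> = real (Suc a) * \<theta> - \<theta>"
    and 2: "real (Suc (Suc a)) * \<theta> = real (Suc a) * \<theta> + \<theta>"
    by (simp_all add: algebra_simps)
  show ?thesis unfolding 1 2 sin_add sin_diff by simp
qed

lemma sin_pos:
  assumes "a < n"
  shows "0 < sin (real (Suc a) * (pi / real (n + 1)))"
proof (rule sin_gt_zero)
  have "real (Suc a) < real (n + 1)" using assms by simp
  then show "real (Suc a) * (pi / real (n + 1)) < pi" by (simp add: field_simps)
qed simp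

lemma sin_last: "sin (real (Suc n) * (pi / real (n + 1))) = 0"
  by simp

lemma cos_nonneg: "1 \<le> n \<Longrightarrow> 0 \<le> cos (pi / real (n + 1))"
  by (rule cos_ge_zero) (auto simp: field_simps intro: order_trans[of _ 0])

lemma sin_vector_form:
  fixes n defines "\<theta> \<equiv> pi / real (n + 1)"
  assumes "1 \<le> n"
  shows "(\<Sum>a<n. sin (real (Suc a) * \<theta>) * sin (real (Suc (Suc a)) * \<theta>)) =
    cos \<theta> * (\<Sum>a<n. (sin (real (Suc a) * \<theta>))\<^sup>2)"
proof -
  obtain k where n: "n = Suc k" using assms by (cases n) auto
  let ?s = "\<lambda>a. sin (real a * \<theta>)"
  have last: "?s (Suc n) = 0" unfolding \<theta>_def by simp
  have A: "(\<Sum>a<n. ?s (Suc a) * ?s (Suc (Suc a))) = (\<Sum>a<k. ?s (Suc a) * ?s (Suc (Suc a)))"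
    using last unfolding n by simp
  have B: "(\<Sum>a<n. ?s (Suc a) * ?s a) = (\<Sum>a<k. ?s (Suc a) * ?s (Suc (Suc a)))"
    unfolding n sum.lessThan_Suc_shift by (simp add: mult.commute del: of_nat_Suc)
  have "(\<Sum>a<n. ?s (Suc a) * ?s (Suc (Suc a))) + (\<Sum>a<n. ?s (Suc a) * ?s a)
      = (\<Sum>a<n. ?s (Suc a) * (?s a + ?s (Suc (Suc a))))"
    unfolding distrib_left sum.distrib by (rule add.commute)
  also have "\<dots> = 2 * (cos \<theta> * (\<Sum>a<n. (?s (Suc a))\<^sup>2))"
    unfolding sin_recurrence
    by (simp add: sum_distrib_left power2_eq_square mult_ac del: of_nat_Suc)
  finally show ?thesis unfolding A B by simp
qed

text \<open>
  A Schur test with the positive eigenvector: the product of the entries at adjacent positions is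
  estimated by the arithmetic-geometric mean inequality with the ratio of the sines at the two
  positions as weight, and the recurrence adds up the coefficients of each square to
  \<open>2 cos \<theta>\<close>.
\<close>

lemma adjacent_products_bound:
  fixes x y :: "nat \<Rightarrow> real"
  defines "\<theta> n \<equiv> pi / real (n + 1 :: nat)"
  assumes "1 \<le> n"
  shows "(\<Sum>a<n - 1. x a * y (Suc a) + y a * x (Suc a))
      \<le> cos (\<theta> n) * ((\<Sum>a<n. (x a)\<^sup>2) + (\<Sum>a<n. (y a)\<^sup>2))"
proof -
  obtain k where n: "n = Suc k" using assms by (cases n) auto
  let ?s = "\<lambda>a. sin (real a * \<theta> n)"
  let ?q = "\<lambda>a. (x a)\<^sup>2 + (y a)\<^sup>2"
  have pos: "0 < ?s (Suc a)" if "a < n" for a using sin_pos[OF that] by (simp add: \<theta>_def)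
  have last: "?s (Suc n) = 0" unfolding \<theta>_def by simp
  have amgm: "2 * (p * q) \<le> p\<^sup>2 * (s / r) + q\<^sup>2 * (r / s)" if "0 < r" "0 < s" for p q r s :: real
  proof -
    have "0 \<le> (p * s - q * r)\<^sup>2 / (r * s)" using that by simp
    also have "\<dots> = p\<^sup>2 * (s / r) + q\<^sup>2 * (r / s) - 2 * (p * q)"
      using that by (simp add: field_simps power2_eq_square)
    finally show ?thesis by simp
  qed
  have "2 * (\<Sum>a<k. x a * y (Suc a) + y a * x (Suc a)) \<le>
      (\<Sum>a<k. ?q a * (?s (Suc (Suc a)) / ?s (Suc a))
          + ?q (Suc a) * (?s (Suc a) / ?s (Suc (Suc a))))"
    unfolding sum_distrib_left
  proof (rule sum_mono)
    fix a assume "a \<in> {..<k}"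
    then have p: "0 < ?s (Suc a)" "0 < ?s (Suc (Suc a))" using n pos[of a] pos[of "Suc a"] by auto
    show "2 * (x a * y (Suc a) + y a * x (Suc a)) \<le>
      ?q a * (?s (Suc (Suc a)) / ?s (Suc a)) + ?q (Suc a) * (?s (Suc a) / ?s (Suc (Suc a)))"
      using amgm[OF p, of "x a" "y (Suc a)"] amgm[OF p, of "y a" "x (Suc a)"]
      unfolding distrib_left distrib_right by linarith
  qed
  also have "\<dots> = (\<Sum>a<k. ?q a * (?s (Suc (Suc a)) / ?s (Suc a)))
       + (\<Sum>a<k. ?q (Suc a) * (?s (Suc a) / ?s (Suc (Suc a))))"
    by (rule sum.distrib)
  also have "(\<Sum>a<k. ?q a * (?s (Suc (Suc a)) / ?s (Suc a)))
      = (\<Sum>a<n. ?q a * (?s (Suc (Suc a)) / ?s (Suc a)))"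
    using last unfolding n by simp
  also have "(\<Sum>a<k. ?q (Suc a) * (?s (Suc a) / ?s (Suc (Suc a))))
      = (\<Sum>a<n. ?q a * (?s a / ?s (Suc a)))"
    unfolding n sum.lessThan_Suc_shift by (simp del: of_nat_Suc)
  also have "(\<Sum>a<n. ?q a * (?s (Suc (Suc a)) / ?s (Suc a))) + (\<Sum>a<n. ?q a * (?s a / ?s (Suc a)))
      = (\<Sum>a<n. 2 * cos (\<theta> n) * ?q a)"
    unfolding sum.distrib[symmetric]
  proof (rule sum.cong[OF refl])
    fix a assume "a \<in> {..<n}"
    then have p: "?s (Suc a) \<noteq> 0" using pos[of a] by auto
    have "?q a * (?s (Suc (Suc a)) / ?s (Suc a)) + ?q a * (?s a / ?s (Suc a))
       = ?q a * ((?s a + ?s (Suc (Suc a))) / ?s (Suc a))"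
      by (simp add: algebra_simps add_divide_distrib del: of_nat_Suc)
    also have "\<dots> = 2 * cos (\<theta> n) * ?q a" unfolding sin_recurrence using p by simp
    finally show "?q a * (?s (Suc (Suc a)) / ?s (Suc a)) + ?q a * (?s a / ?s (Suc a))
        = 2 * cos (\<theta> n) * ?q a" .
  qed
  finally show ?thesis unfolding n by (simp add: sum_distrib_left[symmetric] sum.distrib)
qed

text \<open>
  Real numbers between \<open>c\<close> and \<open>c + \<sigma> cos \<theta>\<close> belong to the numerical range of the Jordan block: the
  second end is attained at the sine vector, with alternating signs if \<open>\<sigma> = -1\<close>, and the first at the
  unit vector of position \<open>0\<close>.  Using both vectors, a convex combination reaches all numbers in between.
\<close>

lemma convex_dilation_numerical_range:
  fixes \<sigma> r c :: real
  assumes n: "1 \<le> n" and \<sigma>: "\<sigma> * \<sigma> = 1" and r: "0 \<le> r" "r \<le> cos (pi / real (n + 1))"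
  shows "\<exists>t. convex_dilation 1 (jordan_block 1 (complex_of_real (c + \<sigma> * r))) t
    n (jordan_block n (complex_of_real c)) n (jordan_block n (complex_of_real c))"
proof -
  let ?\<theta> = "pi / real (n + 1)"
  \<comment> \<open>For \<open>n = 1\<close> the cosine is \<open>0\<close>; then \<open>r = 0\<close> and \<open>t = 0 / 0 = 0\<close>.\<close>
  define t where "t = r / cos ?\<theta>"
  have c0: "0 \<le> cos ?\<theta>" by (rule cos_nonneg[OF n])
  have t: "0 \<le> t" "t \<le> 1" using c0 r by (auto simp: t_def divide_le_eq_1)
  have rt: "r = t * cos ?\<theta>" using r c0 by (auto simp: t_def)
  let ?s = "\<lambda>a. sin (real (Suc a) * ?\<theta>)"
  define M where "M = (\<Sum>a<n. (?s a)\<^sup>2)"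
  have M: "0 < M" unfolding M_def using n sin_pos[of _ n]
    by (intro sum_pos) (auto simp del: of_nat_Suc simp: less_imp_neq[THEN not_sym]
        lessThan_empty_iff)
  define \<xi> where "\<xi> a = \<sigma> ^ a * ?s a / sqrt M" for a
  have \<sigma>2: "\<sigma> ^ a * \<sigma> ^ a = 1" for a by (metis \<sigma> power_mult_distrib power_one)
  have "(\<Sum>a<n. \<xi> a * \<xi> a) = (\<Sum>a<n. (\<sigma> ^ a * \<sigma> ^ a) * (?s a)\<^sup>2 / M)"
    unfolding \<xi>_def using M by (intro sum.cong refl) (simp add: power2_eq_square field_simps)
  also have "\<dots> = 1" using M by (simp add: \<sigma>2 M_def sum_divide_distrib[symmetric] del: of_nat_Suc)
  finally have ip1: "(\<Sum>a<n. \<xi> a * \<xi> a) = 1" .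
  have "(\<Sum>a<n. \<xi> a * (if Suc a < n then \<xi> (Suc a) else 0)) = (\<Sum>a<n. \<sigma> * (?s a * ?s (Suc a)) / M)"
  proof (rule sum.cong[OF refl])
    fix a assume "a \<in> {..<n}"
    then consider "Suc a < n" | "Suc a = n" by fastforce
    then show "\<xi> a * (if Suc a < n then \<xi> (Suc a) else 0) = \<sigma> * (?s a * ?s (Suc a)) / M"
    proof cases
      case 1
      have "\<xi> a * \<xi> (Suc a) = (\<sigma> ^ a * \<sigma> ^ a) * \<sigma> * (?s a * ?s (Suc a)) / M"
        unfolding \<xi>_def using M by (simp add: field_simps del: of_nat_Suc)
      then show ?thesis using 1 by (simp add: \<sigma>2 del: of_nat_Suc)
    next
      case 2
      then have "?s (Suc a) = 0" using sin_last[of n] by simp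
      then show ?thesis using 2 by simp
    qed
  qed
  also have "\<dots> = \<sigma> * ((\<Sum>a<n. ?s a * ?s (Suc a)) / M)"
    by (simp add: sum_distrib_left sum_divide_distrib del: of_nat_Suc)
  also have "\<dots> = \<sigma> * cos ?\<theta>" unfolding sin_vector_form[OF n] M_def[symmetric] using M by simp
  finally have ip2: "(\<Sum>a<n. \<xi> a * (if Suc a < n then \<xi> (Suc a) else 0)) = \<sigma> * cos ?\<theta>" .
  define U where "U u = (\<lambda>i. complex_of_real (\<xi> i) * u 0)" for u :: "nat \<Rightarrow> complex"
  define V where "V u = (\<lambda>i :: nat. if i = 0 then u 0 else 0)" for u :: "nat \<Rightarrow> complex"
  have U1: "fip n (U u) (U v) = fip 1 u v" for u v
  proof -
    have "fip n (U u) (U v) = complex_of_real (\<Sum>a<n. \<xi> a * \<xi> a) * (cnj (u 0) * v 0)"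
      unfolding fip_def U_def of_real_sum sum_distrib_right
      by (intro sum.cong refl) (simp add: mult_ac)
    then show ?thesis unfolding ip1 by (simp add: fip_def)
  qed
  have U2: "fip n (U u) (shift n (U v)) = complex_of_real (\<sigma> * cos ?\<theta>) * fip 1 u v" for u v
  proof -
    have "fip n (U u) (shift n (U v)) =
        complex_of_real (\<Sum>a<n. \<xi> a * (if Suc a < n then \<xi> (Suc a) else 0)) * (cnj (u 0) * v 0)"
      unfolding fip_def U_def shift_def of_real_sum sum_distrib_right
      by (intro sum.cong refl) (simp add: mult_ac)
    then show ?thesis unfolding ip2 by (simp add: fip_def)
  qed
  have V1: "fip n (V u) (V v) = fip 1 u v" for u v
    unfolding fip_def using n by (subst sum_zero_extend[of 1]) (auto simp: V_def)
  have V2: "fip n (V u) (shift n (V v)) = 0" for u v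
    unfolding fip_def V_def shift_def by (intro sum.neutral) auto
  have S: "fip 1 u (shift 1 v) = 0" for u v by (simp add: fip_def shift_def)
  have "convex_dilation 1 (jordan_block 1 (complex_of_real (c + \<sigma> * r))) t
    n (jordan_block n (complex_of_real c)) n (jordan_block n (complex_of_real c))"
    unfolding convex_dilation_def sesq_jordan_block
    using t by (intro conjI exI[of _ U] exI[of _ V] allI)
      (simp_all only: U1 U2 V1 V2 S rt of_real_add of_real_mult of_real_diff of_real_1,
          simp_all add: algebra_simps)
  then show ?thesis by blast
qed

section \<open>Norms of shifted Jordan blocks\<close>

lemma op_norm_leI_power2:
  assumes "A \<in> carrier_mat n n" "0 \<le> c" "\<And>u. (fnorm n (fmul n A u))\<^sup>2 \<le> c\<^sup>2 * (fnorm n u)\<^sup>2"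
  shows "op_norm A \<le> c"
proof (rule op_norm_leI[OF assms(1,2)])
  fix u
  show "fnorm n (fmul n A u) \<le> c * fnorm n u"
    by (rule power2_le_imp_le) (use assms(3)[of u] assms(2) in \<open>simp_all add: power_mult_distrib\<close>)
qed

lemma op_norm_le_symmetricI:
  assumes A: "A \<in> carrier_mat n n" and c: "0 \<le> c"
    and bd: "\<And>u v. cmod (sesq n A u v) \<le> c / 2 * ((fnorm n u)\<^sup>2 + (fnorm n v)\<^sup>2)"
  shows "op_norm A \<le> c"
proof (rule op_norm_leI[OF A c])
  fix u
  let ?w = "fmul n A u"
  show "fnorm n ?w \<le> c * fnorm n u"
  proof (cases "fnorm n u = 0 \<or> fnorm n ?w = 0")
    case True
    then show ?thesis using fnorm_fmul_le[OF A, of u] c by auto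
  next
    case False
    then have pos: "0 < fnorm n u" "0 < fnorm n ?w" by (auto simp: order_less_le)
    \<comment> \<open>Rescaling \<open>u\<close> to the length of \<open>?w\<close> makes the sum of the squares equal to twice the product.\<close>
    define r where "r = fnorm n ?w / fnorm n u"
    have r: "0 < r" "r * fnorm n u = fnorm n ?w" using pos by (auto simp: r_def)
    have "sesq n A ?w (\<lambda>a. complex_of_real r * u a) = complex_of_real (r * (fnorm n ?w)\<^sup>2)"
      unfolding sesq_eq_fip fmul_cmult of_real_mult fip_self[symmetric]
      by (simp add: fip_def sum_distrib_left mult_ac)
    then have "cmod (sesq n A ?w (\<lambda>a. complex_of_real r * u a)) = r * (fnorm n ?w)\<^sup>2"
      using r by (simp only: norm_of_real) simp
    then have "r * (fnorm n ?w)\<^sup>2 \<le> c / 2 * ((fnorm n ?w)\<^sup>2 + (r * fnorm n u)\<^sup>2)"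
      using bd[of ?w "\<lambda>a. complex_of_real r * u a"] r by (simp add: fnorm_cmult)
    also have "\<dots> = c * (fnorm n ?w)\<^sup>2" unfolding r(2) by simp
    finally have "r \<le> c" using pos by simp
    then have "r * fnorm n u \<le> c * fnorm n u" by (rule mult_right_mono) simp
    then show ?thesis by (simp add: r(2))
  qed
qed

lemma abs_eq_1_if_square_eq_1: "\<sigma> * \<sigma> = 1 \<Longrightarrow> \<bar>\<sigma>\<bar> = 1" for \<sigma> :: real
  by (auto simp: square_eq_1_iff)

text \<open>
  With entries \<open>\<bar>u\<^sub>a\<bar>\<close>, and signs \<open>\<sigma>\<^sup>a\<close> that absorb the sign in front of the shift, no cancellation
  occurs between the scalar and the shift.  The squared norm for \<open>\<delta>\<close> therefore exceeds the one for
  \<open>\<epsilon>\<close> at least by \<open>\<delta>\<^sup>2 - \<epsilon>\<^sup>2\<close>, and padding with zeros costs nothing.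
\<close>

lemma shift_vector_compare:
  fixes \<sigma> \<delta> \<epsilon> :: real
  assumes "k \<le> n" "\<sigma> * \<sigma> = 1" "0 \<le> \<epsilon>" "\<epsilon> \<le> \<delta>"
  obtains w where "fnorm n w = fnorm k u"
    "(fnorm k (\<lambda>a. complex_of_real \<epsilon> * u a + complex_of_real \<sigma> * shift k u a))\<^sup>2
        + (\<delta>\<^sup>2 - \<epsilon>\<^sup>2) * (fnorm k u)\<^sup>2
       \<le> (fnorm n (\<lambda>a. complex_of_real \<delta> * w a + complex_of_real \<sigma> * shift n w a))\<^sup>2"
proof
  define x where "x a = (if a < k then cmod (u a) else 0)" for a
  define w where "w a = complex_of_real (\<sigma> ^ a * x a)" for a
  have \<sigma>1: "\<bar>\<sigma>\<bar> = 1" by (rule abs_eq_1_if_square_eq_1[OF assms(2)])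
  have \<sigma>a: "\<bar>\<sigma> ^ a\<bar> = 1" for a by (simp add: power_abs \<sigma>1)
  have cw: "cmod (w a) = x a" for a unfolding w_def by (simp only: norm_of_real abs_mult \<sigma>a)
      (simp add: x_def)
  have "(fnorm n w)\<^sup>2 = (fnorm k u)\<^sup>2"
    unfolding fnorm_power2 cw using assms(1) by (subst sum_zero_extend[of k]) (auto simp: x_def)
  then show "fnorm n w = fnorm k u" by (rule power2_eq_imp_eq) auto
  have x0: "0 \<le> x a" for a by (simp add: x_def)
  have lhs: "(cmod (complex_of_real \<epsilon> * u a + complex_of_real \<sigma> * shift k u a))\<^sup>2
      + (\<delta>\<^sup>2 - \<epsilon>\<^sup>2) * (cmod (u a))\<^sup>2
      \<le> (\<delta> * x a + x (Suc a))\<^sup>2" if "a < k" for a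
  proof -
    have "cmod (complex_of_real \<epsilon> * u a + complex_of_real \<sigma> * shift k u a) \<le> \<epsilon> * x a + x (Suc a)"
      using that assms(3) \<sigma>1 by (intro order_trans[OF norm_triangle_ineq])
          (auto simp: norm_mult x_def shift_def)
    then have "(cmod (complex_of_real \<epsilon> * u a + complex_of_real \<sigma> * shift k u a))\<^sup>2
        \<le> (\<epsilon> * x a + x (Suc a))\<^sup>2"
      by (rule power_mono) simp
    also have "\<dots> = (\<delta> * x a + x (Suc a))\<^sup>2 - (\<delta>\<^sup>2 - \<epsilon>\<^sup>2) * (x a)\<^sup>2 - 2 * (\<delta> - \<epsilon>) *
        (x a * x (Suc a))"
      by (simp add: power2_eq_square algebra_simps)
    also have "\<dots> \<le> (\<delta> * x a + x (Suc a))\<^sup>2 - (\<delta>\<^sup>2 - \<epsilon>\<^sup>2) * (x a)\<^sup>2"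
      using assms(4) x0 by simp
    finally show ?thesis using that by (simp add: x_def)
  qed
  have rhs: "cmod (complex_of_real \<delta> * w a + complex_of_real \<sigma> * shift n w a)
      = \<delta> * x a + x (Suc a)" if "a < n" for a
  proof -
    have sw: "shift n w a = w (Suc a)" using that assms(1) by (auto simp: shift_def w_def x_def)
    have "complex_of_real \<delta> * w a + complex_of_real \<sigma> * shift n w a =
        complex_of_real (\<sigma> ^ a * (\<delta> * x a + (\<sigma> * \<sigma>) * x (Suc a)))"
      unfolding sw w_def by (simp add: algebra_simps)
    then show ?thesis
      unfolding assms(2) using x0[of a] x0[of "Suc a"] assms(3,4)
      by (simp only: norm_of_real abs_mult \<sigma>a) simp
  qed
  have "(\<Sum>a<k. (cmod (complex_of_real \<epsilon> * u a + complex_of_real \<sigma> * shift k u a))\<^sup>2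
      + (\<delta>\<^sup>2 - \<epsilon>\<^sup>2) * (cmod (u a))\<^sup>2)
      \<le> (\<Sum>a<k. (\<delta> * x a + x (Suc a))\<^sup>2)"
    by (intro sum_mono lhs) auto
  also have "\<dots> \<le> (\<Sum>a<n. (\<delta> * x a + x (Suc a))\<^sup>2)" using assms(1) by (intro sum_mono2) auto
  finally show "(fnorm k (\<lambda>a. complex_of_real \<epsilon> * u a + complex_of_real \<sigma> * shift k u a))\<^sup>2
      + (\<delta>\<^sup>2 - \<epsilon>\<^sup>2) * (fnorm k u)\<^sup>2
       \<le> (fnorm n (\<lambda>a. complex_of_real \<delta> * w a + complex_of_real \<sigma> * shift n w a))\<^sup>2"
    unfolding fnorm_power2 by (simp add: rhs sum.distrib sum_distrib_left)
qed

lemma fnorm_cong: "(\<And>a. a < n \<Longrightarrow> u a = v a) \<Longrightarrow> fnorm n u = fnorm n v"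
  unfolding fnorm_def by (rule L2_set_cong) auto

lemma fnorm_delta: "i < n \<Longrightarrow> fnorm n (\<lambda>a. if a = i then c else 0) = cmod c"
proof (rule power2_eq_imp_eq)
  assume "i < n"
  have "(\<Sum>a<n. (cmod (if a = i then c else 0))\<^sup>2) = (\<Sum>a<n. if a = i then (cmod c)\<^sup>2 else 0)"
    by (intro sum.cong refl) auto
  then show "(fnorm n (\<lambda>a. if a = i then c else 0))\<^sup>2 = (cmod c)\<^sup>2"
    unfolding fnorm_power2 using \<open>i < n\<close> by simp
qed auto

lemma op_norm_shift_strict_mono:
  fixes \<sigma> \<delta> \<epsilon> :: real
  assumes "1 \<le> k" "k \<le> n" "\<sigma> * \<sigma> = 1" "0 \<le> \<epsilon>" "\<epsilon> < \<delta>"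
    and A: "A \<in> carrier_mat k k"
      "\<And>u a. a < k \<Longrightarrow> fmul k A u a = complex_of_real \<epsilon> * u a + complex_of_real \<sigma> * shift k u a"
    and B: "B \<in> carrier_mat n n"
      "\<And>u a. a < n \<Longrightarrow> fmul n B u a = complex_of_real \<delta> * u a + complex_of_real \<sigma> * shift n u a"
  shows "op_norm A < op_norm B"
proof -
  let ?\<eta> = "\<delta>\<^sup>2 - \<epsilon>\<^sup>2"
  have eta: "0 < ?\<eta>" using assms by (simp add: power_strict_mono)
  have bd: "(fnorm k (fmul k A u))\<^sup>2 \<le> ((op_norm B)\<^sup>2 - ?\<eta>) * (fnorm k u)\<^sup>2" for u
  proof -
    obtain w where w: "fnorm n w = fnorm k u"
      "(fnorm k (\<lambda>a. complex_of_real \<epsilon> * u a + complex_of_real \<sigma> * shift k u a))\<^sup>2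
          + ?\<eta> * (fnorm k u)\<^sup>2
       \<le> (fnorm n (\<lambda>a. complex_of_real \<delta> * w a + complex_of_real \<sigma> * shift n w a))\<^sup>2"
      using shift_vector_compare[of k n \<sigma> \<epsilon> \<delta> u] assms(2-5) by auto
    have "(fnorm k (fmul k A u))\<^sup>2 + ?\<eta> * (fnorm k u)\<^sup>2 \<le> (fnorm n (fmul n B w))\<^sup>2"
    proof -
      have "fnorm k (fmul k A u) =
          fnorm k (\<lambda>a. complex_of_real \<epsilon> * u a + complex_of_real \<sigma> * shift k u a)"
        by (rule fnorm_cong) (rule A(2))
      moreover have "fnorm n (fmul n B w) =
          fnorm n (\<lambda>a. complex_of_real \<delta> * w a + complex_of_real \<sigma> * shift n w a)"
        by (rule fnorm_cong) (rule B(2))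
      ultimately show ?thesis using w(2) by (simp only:)
    qed
    also have "\<dots> \<le> (op_norm B * fnorm n w)\<^sup>2" by (intro power_mono fnorm_fmul_le B) auto
    finally show ?thesis unfolding w(1) by (simp add: power_mult_distrib algebra_simps)
  qed
  have "0 \<le> (op_norm B)\<^sup>2 - ?\<eta>"

  proof -
    let ?e = "\<lambda>a :: nat. if a = 0 then 1 else 0 :: complex"
    have "fnorm k ?e = 1" using fnorm_delta[of 0 k 1] assms(1) by simp
    moreover have "0 \<le> ((op_norm B)\<^sup>2 - ?\<eta>) * (fnorm k ?e)\<^sup>2"
      by (rule order_trans[OF zero_le_power2 bd])
    ultimately show ?thesis by simp
  qed
  then have "op_norm A \<le> sqrt ((op_norm B)\<^sup>2 - ?\<eta>)"
    using bd by (intro op_norm_leI_power2[OF A(1)]) auto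
  also have "\<dots> < sqrt ((op_norm B)\<^sup>2)"
    by (rule real_sqrt_less_mono) (use eta in linarith)
  also have "\<dots> = op_norm B" using op_norm_nonneg[OF B(1)] by simp
  finally show ?thesis .
qed

lemma op_norm_shift_le_1:
  assumes A: "A \<in> carrier_mat n n" and "\<bar>\<sigma>\<bar> = 1"
    and f: "\<And>u a. a < n \<Longrightarrow> fmul n A u a = complex_of_real \<sigma> * shift n u a"
  shows "op_norm A \<le> 1"
proof (rule op_norm_leI_power2[OF A])
  fix u
  have "(fnorm n (fmul n A u))\<^sup>2 = (\<Sum>a<n. if Suc a < n then (cmod (u (Suc a)))\<^sup>2 else 0)"
    unfolding fnorm_power2 using assms by (intro sum.cong refl) (auto simp: shift_def norm_mult)
  also have "\<dots> \<le> (\<Sum>a<n. (cmod (u a))\<^sup>2)"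
  proof (cases n)
    case (Suc k)
    have "(\<Sum>a<Suc k. if Suc a < Suc k then (cmod (u (Suc a)))\<^sup>2 else 0)
        = (\<Sum>a<k. (cmod (u (Suc a)))\<^sup>2)"
      by simp
    also have "\<dots> \<le> (\<Sum>a<Suc k. (cmod (u a))\<^sup>2)" unfolding sum.lessThan_Suc_shift by simp
    finally show ?thesis using Suc by simp
  qed simp
  finally show "(fnorm n (fmul n A u))\<^sup>2 \<le> 1\<^sup>2 * (fnorm n u)\<^sup>2" by (simp add: fnorm_power2)
qed simp

text \<open>
  The unit vector at position \<open>1\<close> is mapped to a vector with entries \<open>\<plusminus>1\<close> and \<open>\<delta>\<close>.
\<close>

lemma op_norm_shift_gt_1:
  assumes B: "B \<in> carrier_mat n n" and "2 \<le> n" "\<bar>\<sigma>\<bar> = 1" "0 < \<delta>"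
    and f: "\<And>u a. a < n \<Longrightarrow>
      fmul n B u a = complex_of_real \<delta> * u a + complex_of_real \<sigma> * shift n u a"
  shows "1 < op_norm B"
proof -
  let ?e = "\<lambda>a. if a = 1 then 1 else 0 :: complex"
  have e: "fnorm n ?e = 1" using assms fnorm_delta[of 1 n 1] by simp
  have "1 < \<delta>\<^sup>2 + 1" using assms by simp
  also have "\<dots> = (\<Sum>a\<in>{0, 1}. (cmod (fmul n B ?e a))\<^sup>2)"
    using assms by (simp add: shift_def norm_mult)
  also have "\<dots> \<le> (fnorm n (fmul n B ?e))\<^sup>2"
    unfolding fnorm_power2 using assms by (intro sum_mono2) auto
  also have "\<dots> \<le> (op_norm B)\<^sup>2"
    using fnorm_fmul_le[OF B, of ?e] unfolding e by (intro power_mono) auto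
  finally have "1\<^sup>2 < (op_norm B)\<^sup>2" by simp
  then show ?thesis using op_norm_nonneg[OF B] by (rule power2_less_imp_less)
qed

section \<open>Peaking at the extreme Jordan blocks\<close>

context jordan_blocks
begin

lemma fmul_os_block_shift:
  assumes "a < m k"
  shows "fmul (m k) (os_block (complex_of_real (- \<sigma> * \<mu>)) (complex_of_real \<sigma>) 0 k) u a =
    complex_of_real (\<sigma> * (l k - \<mu>)) * u a + complex_of_real \<sigma> * shift (m k) u a"
proof -
  have "fmul (m k) (os_block (complex_of_real (- \<sigma> * \<mu>)) (complex_of_real \<sigma>) 0 k) u a =
      (\<Sum>b<m k. (if b = a then complex_of_real (\<sigma> * (l k - \<mu>)) * u a else 0) +
        (if b = Suc a then complex_of_real \<sigma> * u (Suc a) else 0))"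
    unfolding fmul_def os_block_def jblock_def using assms
    by (intro sum.cong refl)
      (auto simp: carrier_matD[OF mat_adjoint_carrier[OF jordan_block_carrier]] algebra_simps)
  then show ?thesis using assms by (simp add: sum.distrib shift_def)
qed

lemma peakingI:
  assumes "g \<in> set ks" "g \<noteq> f"
    and lt: "\<And>k. k \<in> set ks \<Longrightarrow> k \<noteq> f \<Longrightarrow> op_norm (os_block a b c k) < op_norm (os_block a b c f)"
  shows "peaking f"
proof -
  let ?S = "(\<lambda>k. op_norm (os_block a b c k)) ` (set ks - {f})"
  have S: "finite ?S" "?S \<noteq> {}" using assms by auto
  have "op_norm (os_block a b c g) \<le> Max ?S" using assms by (intro Max_ge S) auto
  then have "0 \<le> Max ?S" using op_norm_nonneg[OF famD[OF os_block_fam], of a b c g] by simp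
  moreover have "Max ?S < op_norm (os_block a b c f)" using S lt by simp
  moreover have "\<forall>k \<in> set ks - {f}. op_norm (os_block a b c k) \<le> Max ?S" using S by simp
  ultimately show ?thesis unfolding peaking_def by blast
qed

text \<open>
  The element \<open>\<sigma> (T - l g)\<close> peaks at \<open>f\<close> if \<open>f\<close> lies furthest from \<open>g\<close> on the side given by \<open>\<sigma>\<close>.  Larger blocks
  than \<open>f\<close> are possible only for \<open>g\<close> itself, where the scalar part vanishes and the norm is at most \<open>1\<close>.
\<close>

lemma peaking_by_shift:
  assumes f: "f \<in> set ks" and g: "g \<in> set ks" "g \<noteq> f" and \<sigma>: "\<sigma> * \<sigma> = 1"
    and order: "\<And>k. k \<in> set ks \<Longrightarrow> k \<noteq> f \<Longrightarrow> 0 \<le> \<sigma> * (l k - l g) \<and> \<sigma> * (l k - l g) < \<sigma> * (l f - l g)"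
    and size: "\<And>k. k \<in> set ks \<Longrightarrow> k \<noteq> f \<Longrightarrow> k \<noteq> g \<Longrightarrow> m k \<le> m f" "2 \<le> m f \<or> m g \<le> m f"
  shows "peaking f"
proof (rule peakingI[OF g])
  let ?X = "os_block (complex_of_real (- \<sigma> * l g)) (complex_of_real \<sigma>) 0"
  fix k assume k: "k \<in> set ks" "k \<noteq> f"
  have \<sigma>1: "\<bar>\<sigma>\<bar> = 1" by (rule abs_eq_1_if_square_eq_1[OF \<sigma>])
  show "op_norm (?X k) < op_norm (?X f)"
  proof (cases "m k \<le> m f")
    case True
    show ?thesis
      by (rule op_norm_shift_strict_mono[of "m k" "m f" \<sigma> "\<sigma> * (l k - l g)" "\<sigma> * (l f - l g)"])
        (use True \<sigma> order[OF k] m_pos[OF k(1)] in \<open>simp_all add: fmul_os_block_shift del: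
            of_real_mult of_real_diff mult_minus_left minus_mult_left\<close>)
  next
    case False
    then have kg: "k = g" and mf: "2 \<le> m f" using size k by auto
    have "op_norm (?X k) \<le> 1"
      by (rule op_norm_shift_le_1[OF famD[OF os_block_fam] \<sigma>1])
          (simp add: fmul_os_block_shift kg del: of_real_mult mult_minus_left)
    also have "1 < op_norm (?X f)"
      by (rule op_norm_shift_gt_1[OF famD[OF os_block_fam] mf \<sigma>1, of "\<sigma> * (l f - l g)"])
        (use order[OF k] in \<open>simp_all add: fmul_os_block_shift del: of_real_mult of_real_diff
            mult_minus_left\<close>)
    finally show ?thesis .
  qed
qed

lemma sesq_real_part:
  "sesq (m k) (os_block (complex_of_real (- 2 * \<sigma> * \<mu>)) (complex_of_real \<sigma>)
      (complex_of_real \<sigma>) k) u v =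
    complex_of_real (2 * \<sigma> * (l k - \<mu>)) * fip (m k) u v +
    complex_of_real \<sigma> * (fip (m k) u (shift (m k) v) + cnj (fip (m k) v (shift (m k) u)))"
proof -
  have "cnj (fip (m k) v u) = fip (m k) u v" by (simp add: fip_def mult.commute)
  then show ?thesis unfolding sesq_os_block jblock_def sesq_jordan_block
    by (simp add: algebra_simps)
qed

text \<open>
  Here \<open>f\<close> is one-dimensional and \<open>g\<close> may be large.  The shift of block \<open>g\<close> can then have norm \<open>1\<close>, which the
  distance of \<open>f\<close> to \<open>g\<close> need not exceed, so \<open>\<sigma> (T - l g)\<close> does not help.  Twice its real part does: on
  \<open>g\<close> its norm is at most \<open>2 cos (\<pi> / (m g + 1))\<close>.
\<close>

lemma peaking_by_real_part:
  assumes f: "f \<in> set ks" "m f = 1" and g: "g \<in> set ks" "g \<noteq> f" and \<sigma>: "\<sigma> * \<sigma> = 1"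
    and order: "\<And>k. k \<in> set ks \<Longrightarrow> k \<noteq> f \<Longrightarrow> 0 \<le> \<sigma> * (l k - l g) \<and> \<sigma> * (l k - l g) < \<sigma> * (l f - l g)"
    and size: "\<And>k. k \<in> set ks \<Longrightarrow> k \<noteq> f \<Longrightarrow> k \<noteq> g \<Longrightarrow> m k = 1"
    and gap: "cos (pi / real (m g + 1)) < \<sigma> * (l f - l g)"
  shows "peaking f"
proof (rule peakingI[OF g])
  let ?X = "os_block (complex_of_real (- 2 * \<sigma> * l g)) (complex_of_real \<sigma>) (complex_of_real \<sigma>)"
  fix k assume k: "k \<in> set ks" "k \<noteq> f"
  have \<sigma>1: "\<bar>\<sigma>\<bar> = 1" by (rule abs_eq_1_if_square_eq_1[OF \<sigma>])
  have one: "sesq (m j) (?X j) u v = complex_of_real (2 * \<sigma> * (l j - l g)) * fip (m j) u v"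
    if "m j = 1" for j u v
    unfolding sesq_real_part using that by (simp add: fip_def shift_def)
  have gt: "2 * \<sigma> * (l f - l g) \<le> op_norm (?X f)"
  proof -
    let ?e = "\<lambda>a :: nat. if a = 0 then 1 else 0 :: complex"
    have e: "fnorm (m f) ?e = 1" using fnorm_delta[of 0 "m f" 1] f(2) by simp
    have "cmod (sesq (m f) (?X f) ?e ?e) = \<bar>2 * \<sigma> * (l f - l g)\<bar>"
      unfolding one[OF f(2)] fip_self e by (simp only: norm_mult norm_of_real) simp
    then have "\<bar>2 * \<sigma> * (l f - l g)\<bar> \<le> op_norm (?X f)"
      using sesq_le_op_norm[OF famD[OF os_block_fam, of "complex_of_real (- 2 * \<sigma> * l g)"
          "complex_of_real \<sigma>" "complex_of_real \<sigma>" f], of ?e ?e] unfolding e by linarith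
    then show ?thesis by linarith
  qed
  show "op_norm (?X k) < op_norm (?X f)"
  proof (cases "k = g")
    case False
    have "op_norm (?X k) \<le> 2 * \<sigma> * (l k - l g)"
    proof (rule op_norm_le_sesqI[OF famD[OF os_block_fam]])
      show nn: "0 \<le> 2 * \<sigma> * (l k - l g)" using order[OF k] by (simp add: mult.assoc)
      fix u v
      have "cmod (sesq (m k) (?X k) u v) = 2 * \<sigma> * (l k - l g) * cmod (fip (m k) u v)"
        unfolding one[OF size[OF k False]] norm_mult[of "complex_of_real _"] norm_of_real
            abs_of_nonneg[OF nn] ..
      also have "\<dots> \<le> 2 * \<sigma> * (l k - l g) * (fnorm (m k) u * fnorm (m k) v)"
        by (intro mult_left_mono fip_bound nn)
      finally show "cmod (sesq (m k) (?X k) u v)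
          \<le> 2 * \<sigma> * (l k - l g) * fnorm (m k) u * fnorm (m k) v"
        by (simp add: mult.assoc)
    qed
    also have "\<dots> < 2 * \<sigma> * (l f - l g)" using order[OF k] by (simp add: mult.assoc)
    finally show ?thesis using gt by simp
  next
    case True
    let ?c = "cos (pi / real (m g + 1))" and ?n = "m g"
    have n: "1 \<le> ?n" using m_pos[OF g(1)] .
    have sh: "cmod (fip ?n u (shift ?n v)) \<le> (\<Sum>a<?n - 1. cmod (u a) * cmod (v (Suc a)))" for u v
    proof -
      have "cmod (fip ?n u (shift ?n v)) \<le> (\<Sum>a<?n. cmod (u a) * cmod (shift ?n v a))"
        unfolding fip_def by (rule order_trans[OF norm_sum]) (simp add: norm_mult)
      also have "\<dots> = (\<Sum>a<?n - 1. cmod (u a) * cmod (v (Suc a)))"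
        by (subst sum_zero_extend[of "?n - 1"]) (auto simp: shift_def intro!: sum.cong)
      finally show ?thesis .
    qed
    have "op_norm (?X g) \<le> 2 * ?c"
    proof (rule op_norm_le_symmetricI[OF famD[OF os_block_fam]])
      show "0 \<le> 2 * ?c" using cos_nonneg[OF n] by simp
      fix u v
      have "cmod (sesq ?n (?X g) u v)
          = cmod (fip ?n u (shift ?n v) + cnj (fip ?n v (shift ?n u)))"
        unfolding sesq_real_part by (simp add: norm_mult \<sigma>1)
      also have "\<dots> \<le> cmod (fip ?n u (shift ?n v)) + cmod (fip ?n v (shift ?n u))"
        by (rule order_trans[OF norm_triangle_ineq]) simp
      also have "\<dots> \<le> (\<Sum>a<?n - 1. cmod (u a) * cmod (v (Suc a)) + cmod (v a) * cmod (u (Suc a)))"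
        unfolding sum.distrib by (intro add_mono sh)
      also have "\<dots> \<le> ?c * ((\<Sum>a<?n. (cmod (u a))\<^sup>2) + (\<Sum>a<?n. (cmod (v a))\<^sup>2))"
        by (rule adjacent_products_bound[OF n])
      finally show "cmod (sesq ?n (?X g) u v) \<le> 2 * ?c / 2 * ((fnorm ?n u)\<^sup>2 + (fnorm ?n v)\<^sup>2)"
        by (simp add: fnorm_power2)
    qed
    also have "\<dots> < 2 * \<sigma> * (l f - l g)" using gap by (simp add: mult.assoc)
    finally show ?thesis using gt True by simp
  qed
qed

end

section \<open>The C*-envelope\<close>

theorem corollary2p12:
  fixes n :: nat and m d :: "nat \<Rightarrow> nat" and l :: "nat \<Rightarrow> real"
  assumes n: "n \<ge> 2"
    and m: "\<forall>k\<in>{1..n}. m k \<ge> 1"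
    and d: "\<forall>k\<in>{1..n}. d k \<ge> 1"
    and l: "\<forall>i\<in>{1..n}. \<forall>j\<in>{1..n}. i < j \<longrightarrow> l i > l j"
    and middle: "n > 2 \<longrightarrow> Max (m ` {2..n-1}) \<le> min (m 1) (m n)"
  shows
    "(min (m 1) (m n) \<ge> 2 \<longrightarrow>
        star_isomorphic (cstar_envelope (jordan_sum n m d l))
          (dsum_alg (mat_alg (m 1)) (mat_alg (m n)))) \<and>
     (m 1 = 1 \<and> m n = 1 \<longrightarrow>
        star_isomorphic (cstar_envelope (jordan_sum n m d l))
          (dsum_alg complex_alg complex_alg)) \<and>
     (m 1 = 1 \<and> m n \<ge> 2 \<and> \<bar>l 1 - l n\<bar> \<le> cos (pi / real (m n + 1)) \<longrightarrow>
        star_isomorphic (cstar_envelope (jordan_sum n m d l)) (mat_alg (m n))) \<and>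
     (m 1 = 1 \<and> m n \<ge> 2 \<and> \<bar>l 1 - l n\<bar> > cos (pi / real (m n + 1)) \<longrightarrow>
        star_isomorphic (cstar_envelope (jordan_sum n m d l))
          (dsum_alg complex_alg (mat_alg (m n)))) \<and>
     (m 1 \<ge> 2 \<and> m n = 1 \<and> \<bar>l 1 - l n\<bar> \<le> cos (pi / real (m 1 + 1)) \<longrightarrow>
        star_isomorphic (cstar_envelope (jordan_sum n m d l)) (mat_alg (m 1))) \<and>
     (m 1 \<ge> 2 \<and> m n = 1 \<and> \<bar>l 1 - l n\<bar> > cos (pi / real (m 1 + 1)) \<longrightarrow>
        star_isomorphic (cstar_envelope (jordan_sum n m d l))
          (dsum_alg (mat_alg (m 1)) complex_alg))"
proof -
  define ks where "ks = concat (map (\<lambda>k. replicate (d k) k) [1..<Suc n])"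
  have ks: "set ks = {1..n}" using d by (force simp: ks_def)
  have inj: "inj_on l (set ks)"
  proof (rule inj_onI)
    fix i j assume "i \<in> set ks" "j \<in> set ks" "l i = l j"
    then show "i = j" using l[rule_format, of i j] l[rule_format, of j i] unfolding ks
      by (cases i j rule: linorder_cases) auto
  qed
  interpret J: jordan_blocks ks m l by unfold_locales (use m inj ks in auto)
  have T: "jordan_sum n m d l = J.T"
    unfolding jordan_sum_def J.T_def unfolding ks_def by (simp add: map_concat o_def del: upt_Suc)
  have ends: "1 \<in> set ks" "n \<in> set ks" "1 \<noteq> n" "n \<noteq> 1" using n ks by auto
  have top: "l k < l 1" if "k \<in> set ks" "k \<noteq> 1" for k using l that unfolding ks by auto
  have bot: "l n < l k" if "k \<in> set ks" "k \<noteq> n" for k using l that unfolding ks by auto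
  have gap: "\<bar>l 1 - l n\<bar> = l 1 - l n" using top[OF ends(2,4)] by simp
  have mid: "m k \<le> m 1" "m k \<le> m n" if "k \<in> set ks" "k \<noteq> 1" "k \<noteq> n" for k
  proof -
    have k: "k \<in> {2..n - 1}" "n > 2" using that unfolding ks by auto
    then have "m k \<le> Max (m ` {2..n - 1})" by (intro Max_ge) auto
    then show "m k \<le> m 1" "m k \<le> m n" using middle k by auto
  qed
  let ?dil = "\<lambda>k F. \<exists>t. \<exists>f\<in>F. \<exists>g\<in>F. convex_dilation (m k) (J.jblock k) t (m f) (J.jblock f)
      (m g) (J.jblock g)"
  have dil_self: "?dil k F" if "k \<in> F" for k F using convex_dilation_refl that by blast
  \<comment> \<open>Blocks that can be dropped: all but the extreme ones, or even all but one.\<close>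
  have dil_both: "?dil k {1, n}" if k: "k \<in> set ks" for k
  proof (cases "k = 1 \<or> k = n")
    case True
    then show ?thesis by (intro dil_self) auto
  next
    case False
    let ?t = "(l k - l n) / (l 1 - l n)"
    have pos: "0 < l 1 - l n" using top[OF ends(2,4)] by simp
    have t: "0 \<le> ?t" "?t \<le> 1" using top[OF k] bot[OF k] False pos by auto
    have "l k = l n + ?t * (l 1 - l n)" using pos by simp
    then have "l k = ?t * l 1 + (1 - ?t) * l n" by (simp only: algebra_simps)
    then have "convex_dilation (m k) (J.jblock k) ?t (m 1) (J.jblock 1) (m n) (J.jblock n)"
      unfolding J.jblock_def using mid[OF k] False t by (intro convex_dilation_compress) auto
    then show ?thesis by blast
  qed
  have dil_one: "?dil k {g}"
    if k: "k \<in> set ks" and g: "g \<in> set ks" and one: "k \<noteq> g \<Longrightarrow> m k = 1"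
      and \<sigma>: "\<sigma> * \<sigma> = 1" and r: "0 \<le> \<sigma> * (l k - l g)" "\<sigma> * (l k - l g)
          \<le> cos (pi / real (m g + 1))"
    for k g and \<sigma> :: real
  proof (cases "k = g")
    case False
    have "l k = l g + \<sigma> * (\<sigma> * (l k - l g))" using \<sigma> by (simp add: mult.assoc[symmetric])
    then obtain t where "convex_dilation (m k) (J.jblock k) t (m g) (J.jblock g) (m g)
        (J.jblock g)"
      using convex_dilation_numerical_range[OF J.m_pos[OF g] \<sigma> r, of "l g"] one[OF False]
      unfolding J.jblock_def by auto
    then show ?thesis by blast
  qed (use dil_self in auto)
  \<comment> \<open>Blocks that cannot be dropped; the sign \<open>\<sigma>\<close> is \<open>1\<close> for the first and \<open>- 1\<close> for the last block.\<close>
  have order_top: "0 \<le> 1 * (l k - l n) \<and> 1 * (l k - l n) < 1 * (l 1 - l n)"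
    if "k \<in> set ks" "k \<noteq> 1" for k using top[OF that] bot[OF that(1)] by (cases "k = n") auto
  have order_bot: "0 \<le> - 1 * (l k - l 1) \<and> - 1 * (l k - l 1) < - 1 * (l n - l 1)"
    if "k \<in> set ks" "k \<noteq> n" for k using bot[OF that] top[OF that(1)] by (cases "k = 1") auto
  have peak_top: "J.peaking 1" if "2 \<le> m 1 \<or> m n \<le> m 1"
    by (rule J.peaking_by_shift[OF ends(1,2,4), of 1]) (use order_top mid that in auto)
  have peak_bot: "J.peaking n" if "2 \<le> m n \<or> m 1 \<le> m n"
    by (rule J.peaking_by_shift[OF ends(2,1,3), of "- 1"]) (use order_bot mid that in auto)
  have ones: "m k = 1" if "k \<in> set ks" "k \<noteq> 1" "k \<noteq> n" "m 1 = 1 \<or> m n = 1" for k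
    using mid[OF that(1-3)] J.m_pos[OF that(1)] that(4) by auto
  have peak_top': "J.peaking 1" if "m 1 = 1" "cos (pi / real (m n + 1)) < \<bar>l 1 - l n\<bar>"
    by (rule J.peaking_by_real_part[OF ends(1) that(1) ends(2,4), of 1])
      (use order_top ones that gap in auto)
  have peak_bot': "J.peaking n" if "m n = 1" "cos (pi / real (m 1 + 1)) < \<bar>l 1 - l n\<bar>"
    by (rule J.peaking_by_real_part[OF ends(2) that(1) ends(1,3), of "- 1"])
      (use order_bot ones that gap in auto)
  have two: "star_isomorphic (cstar_envelope J.T) (dsum_alg B C)"
    if "J.peaking 1" "J.peaking n" "ring B" "star_isomorphic (mat_alg (m 1)) B"
      "ring C" "star_isomorphic (mat_alg (m n)) C" for B :: "'b star_alg" and C :: "'c star_alg"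
  proof -
    have "cstar_envelope J.T = quot_alg J.alg (J.block_ideal {1, n})"
      by (rule J.cstar_envelope_eq) (use ends dil_both that(1,2) in auto)
    then show ?thesis
      using J.quotient_block_ideal_two[OF ends(1) that(3,4) ends(2) that(5,6) ends(3)] by simp
  qed
  have single: "star_isomorphic (cstar_envelope J.T) (mat_alg (m g))"
    if "g \<in> set ks" "\<And>k. k \<in> set ks \<Longrightarrow> ?dil k {g}" "J.peaking g" for g
  proof -
    have "cstar_envelope J.T = quot_alg J.alg (J.block_ideal {g})"
      by (rule J.cstar_envelope_eq) (use that in auto)
    then show ?thesis
      using J.quotient_block_ideal_one[OF that(1) ring_mat_alg star_isomorphic_refl] by simp
  qed
  note rings = ring_mat_alg ring_complex_alg
  have C: "star_isomorphic (mat_alg k) complex_alg" if "k = 1" for k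
    using mat_alg_1_iso that by simp
  show ?thesis
    unfolding T
  proof (intro conjI impI; (elim conjE)?)
    assume "min (m 1) (m n) \<ge> 2"
    then show "star_isomorphic (cstar_envelope J.T) (dsum_alg (mat_alg (m 1)) (mat_alg (m n)))"
      by (intro two peak_top peak_bot rings star_isomorphic_refl) auto
  next
    assume "m 1 = 1" "m n = 1"
    then show "star_isomorphic (cstar_envelope J.T) (dsum_alg complex_alg complex_alg)"
      by (intro two peak_top peak_bot rings C) auto
  next
    assume h: "m 1 = 1" "2 \<le> m n" "\<bar>l 1 - l n\<bar> \<le> cos (pi / real (m n + 1))"
    show "star_isomorphic (cstar_envelope J.T) (mat_alg (m n))"
    proof (rule single[OF ends(2)])
      show "J.peaking n" using h by (intro peak_bot) auto
      fix k assume k: "k \<in> set ks"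
      show "?dil k {n}"
      proof (rule dil_one[OF k ends(2), of 1])
        show "m k = 1" if "k \<noteq> n" using ones[OF k] that h by (cases "k = 1") auto
        show "0 \<le> 1 * (l k - l n)" using bot[OF k] by (cases "k = n") auto
        show "1 * (l k - l n) \<le> cos (pi / real (m n + 1))"
          using top[OF k] h(3) unfolding gap by (cases "k = 1") auto
      qed simp
    qed
  next
    assume "m 1 = 1" "2 \<le> m n" "\<bar>l 1 - l n\<bar> > cos (pi / real (m n + 1))"
    then show "star_isomorphic (cstar_envelope J.T) (dsum_alg complex_alg (mat_alg (m n)))"
      by (intro two peak_top' peak_bot rings C star_isomorphic_refl) auto
  next
    assume h: "2 \<le> m 1" "m n = 1" "\<bar>l 1 - l n\<bar> \<le> cos (pi / real (m 1 + 1))"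
    show "star_isomorphic (cstar_envelope J.T) (mat_alg (m 1))"
    proof (rule single[OF ends(1)])
      show "J.peaking 1" using h by (intro peak_top) auto
      fix k assume k: "k \<in> set ks"
      show "?dil k {1}"
      proof (rule dil_one[OF k ends(1), of "- 1"])
        show "m k = 1" if "k \<noteq> 1" using ones[OF k that] h by (cases "k = n") auto
        show "0 \<le> - 1 * (l k - l 1)" using top[OF k] by (cases "k = 1") auto
        show "- 1 * (l k - l 1) \<le> cos (pi / real (m 1 + 1))"
          using bot[OF k] h(3) unfolding gap by (cases "k = n") auto
      qed simp
    qed
  next
    assume "2 \<le> m 1" "m n = 1" "\<bar>l 1 - l n\<bar> > cos (pi / real (m 1 + 1))"
    then show "star_isomorphic (cstar_envelope J.T) (dsum_alg (mat_alg (m 1)) complex_alg)"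
      by (intro two peak_top peak_bot' rings C star_isomorphic_refl) auto
  qed
qed

end
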